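(* Let $G$ be a finite group acting transitively on a finite set $X$, let $x_0\in X$, and let $H=\{h\in G:h\cdot x_0=x_0\}$. For every $\sigma\in\widehat{G}$, the projection $\Pi$ preserves the block $\mathcal{A}_\sigma=\operatorname{span}\{\sigma_{ij}\}$, and $$\dim\left(\mathcal{A}_\sigma\cap L^2(G)^H\right)=d_\sigma m_\sigma,\qquad\text{where } m_\sigma=\frac{1}{|H|}\sum_{h\in H}\chi_\sigma(h).$$ Moreover, $\sum_{\sigma\in\widehat{G}}d_\sigma m_\sigma=|X|$.
   Context: $L^2(G)$ is the space of functions $G\to\mathbb{C}$ with inner product $\langle f,h\rangle=\frac{1}{|G|}\sum_{g\in G}\overline{f(g)}h(g)$, and $L^2(G)^H=\{F\in L^2(G):F(hg)=F(g)\ \forall h\in H,\ g\in G\}$. The operator $\Pi:L^2(G)\to L^2(G)$ is $(\Pi F)(g)=\frac{1}{|H|}\sum_{h\in H}F(hg)$; it is the orthogonal projection onto $L^2(G)^H$. $\widehat{G}$ is the set of equivalence classes of irreducible complex representations of $G$, each represented by a unitary matrix representation $\sigma:G\to U(d_\sigma)$ with matrix entries $\sigma_{ij}$ and character $\chi_\sigma=\operatorname{Tr}\sigma$. *)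

theory Defs
  imports
    "HOL-Algebra.Group_Action"
    "HOL-Library.Function_Algebras"
    "Jordan_Normal_Form.Schur_Decomposition"
    "Jordan_Normal_Form.VS_Connect"
begin

subsection \<open>Complex functions on a finite group\<close>

definition fun_scale :: "complex \<Rightarrow> ('g \<Rightarrow> complex) \<Rightarrow> 'g \<Rightarrow> complex"
  where "fun_scale c f = (\<lambda>x. c * f x)"

interpretation cfun: vector_space fun_scale
  by standard (simp_all add: fun_scale_def fun_eq_iff algebra_simps)

text \<open>
  A function from the carrier of \<open>G\<close> to the complex numbers is encoded as a total function
  that vanishes outside the carrier (not as an \<open>extensional\<close> one, since these do not
  form a linear subspace).
\<close>

definition L2 :: "('g, 'm) monoid_scheme \<Rightarrow> ('g \<Rightarrow> complex) set"
  where "L2 G = {F. \<forall>g. g \<notin> carrier G \<longrightarrow> F g = 0}"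

definition L2_inv :: "('g, 'm) monoid_scheme \<Rightarrow> 'g set \<Rightarrow> ('g \<Rightarrow> complex) set"
  where "L2_inv G H = {F \<in> L2 G. \<forall>h\<in>H. \<forall>g\<in>carrier G. F (h \<otimes>\<^bsub>G\<^esub> g) = F g}"

definition avg_proj :: "('g, 'm) monoid_scheme \<Rightarrow> 'g set \<Rightarrow> ('g \<Rightarrow> complex) \<Rightarrow> 'g \<Rightarrow> complex"
  where "avg_proj G H F = (\<lambda>g. if g \<in> carrier G
    then 1 / of_nat (card H) * (\<Sum>h\<in>H. F (h \<otimes>\<^bsub>G\<^esub> g)) else 0)"

subsection \<open>Matrix representations\<close>

text \<open>
  Only the values on the carrier matter. Together, the last two conditions make every \<open>\<sigma> g\<close>
  invertible, so that \<open>\<sigma>\<close> is a homomorphism into the general linear group of degree \<open>d\<close>.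
\<close>

definition matrix_rep :: "('g, 'm) monoid_scheme \<Rightarrow> nat \<Rightarrow> ('g \<Rightarrow> complex mat) \<Rightarrow> bool"
  where "matrix_rep G d \<sigma> \<longleftrightarrow>
    (\<forall>g\<in>carrier G. \<sigma> g \<in> carrier_mat d d) \<and>
    (\<forall>g\<in>carrier G. \<forall>h\<in>carrier G. \<sigma> (g \<otimes>\<^bsub>G\<^esub> h) = \<sigma> g * \<sigma> h) \<and>
    \<sigma> \<one>\<^bsub>G\<^esub> = 1\<^sub>m d"

definition rep_degree :: "('g, 'm) monoid_scheme \<Rightarrow> ('g \<Rightarrow> complex mat) \<Rightarrow> nat"
  where "rep_degree G \<sigma> = dim_row (\<sigma> \<one>\<^bsub>G\<^esub>)"

definition irreducible_rep :: "('g, 'm) monoid_scheme \<Rightarrow> ('g \<Rightarrow> complex mat) \<Rightarrow> bool"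
  where "irreducible_rep G \<sigma> \<longleftrightarrow>
    matrix_rep G (rep_degree G \<sigma>) \<sigma> \<and> rep_degree G \<sigma> > 0 \<and>
    (\<forall>W. VectorSpace.subspace class_ring W (module_vec TYPE(complex) (rep_degree G \<sigma>)) \<and>
         (\<forall>g\<in>carrier G. \<forall>w\<in>W. \<sigma> g *\<^sub>v w \<in> W) \<longrightarrow>
         W = {0\<^sub>v (rep_degree G \<sigma>)} \<or> W = carrier_vec (rep_degree G \<sigma>))"

definition unitary_rep :: "('g, 'm) monoid_scheme \<Rightarrow> ('g \<Rightarrow> complex mat) \<Rightarrow> bool"
  where "unitary_rep G \<sigma> \<longleftrightarrow>
    matrix_rep G (rep_degree G \<sigma>) \<sigma> \<and>
    (\<forall>g\<in>carrier G. mat_adjoint (\<sigma> g) * \<sigma> g = 1\<^sub>m (rep_degree G \<sigma>))"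

definition irreps :: "('g, 'm) monoid_scheme \<Rightarrow> ('g \<Rightarrow> complex mat) set"
  where "irreps G = {\<sigma>. irreducible_rep G \<sigma>}"

definition rep_equiv ::
    "('g, 'm) monoid_scheme \<Rightarrow> (('g \<Rightarrow> complex mat) \<times> ('g \<Rightarrow> complex mat)) set"
  where "rep_equiv G = {(\<sigma>, \<tau>). \<sigma> \<in> irreps G \<and> \<tau> \<in> irreps G \<and>
    rep_degree G \<sigma> = rep_degree G \<tau> \<and>
    (\<exists>P \<in> carrier_mat (rep_degree G \<sigma>) (rep_degree G \<sigma>). invertible_mat P \<and>
       (\<forall>g\<in>carrier G. P * \<sigma> g = \<tau> g * P))}"

text \<open>
  An irreducible complex representation of a finite group is finite-dimensional, so a choice of
  basis makes it a matrix representation; the classes of matrix representations are thus all of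
  the dual. Functions that differ only outside the carrier lie in the same class.
\<close>

definition dual :: "('g, 'm) monoid_scheme \<Rightarrow> ('g \<Rightarrow> complex mat) set set"
  where "dual G = irreps G // rep_equiv G"

definition unitary_representatives ::
    "('g, 'm) monoid_scheme \<Rightarrow> (('g \<Rightarrow> complex mat) set \<Rightarrow> 'g \<Rightarrow> complex mat) \<Rightarrow> bool"
  where "unitary_representatives G \<rho> \<longleftrightarrow> (\<forall>C\<in>dual G. \<rho> C \<in> C \<and> unitary_rep G (\<rho> C))"

definition matrix_entry ::
    "('g, 'm) monoid_scheme \<Rightarrow> ('g \<Rightarrow> complex mat) \<Rightarrow> nat \<Rightarrow> nat \<Rightarrow> 'g \<Rightarrow> complex"
  where "matrix_entry G \<sigma> i j = (\<lambda>g. if g \<in> carrier G then \<sigma> g $$ (i, j) else 0)"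

definition block :: "('g, 'm) monoid_scheme \<Rightarrow> ('g \<Rightarrow> complex mat) \<Rightarrow> ('g \<Rightarrow> complex) set"
  where "block G \<sigma> =
    cfun.span {matrix_entry G \<sigma> i j | i j. i < rep_degree G \<sigma> \<and> j < rep_degree G \<sigma>}"

definition character :: "('g \<Rightarrow> complex mat) \<Rightarrow> 'g \<Rightarrow> complex"
  where "character \<sigma> g = (\<Sum>i<dim_row (\<sigma> g). \<sigma> g $$ (i, i))"

definition fixed_mult :: "'g set \<Rightarrow> ('g \<Rightarrow> complex mat) \<Rightarrow> complex"
  where "fixed_mult H \<sigma> = 1 / of_nat (card H) * (\<Sum>h\<in>H. character \<sigma> h)"

subsection \<open>Equivalence of representations is an equivalence relation\<close>

lemma invertible_matE:
  assumes "invertible_mat P" "P \<in> carrier_mat d d"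
  obtains Q where "Q \<in> carrier_mat d d" "P * Q = 1\<^sub>m d" "Q * P = 1\<^sub>m d"
proof -
  from assms obtain Q where Q: "P * Q = 1\<^sub>m d" "Q * P = 1\<^sub>m (dim_row Q)"
    unfolding invertible_mat_def inverts_mat_def by auto
  have "dim_col Q = d" using arg_cong[OF Q(1), of dim_col] by simp
  moreover have "dim_row Q = d" using arg_cong[OF Q(2), of dim_col] assms(2) by simp
  ultimately show ?thesis using that Q by auto
qed

lemma invertible_matI:
  assumes "P \<in> carrier_mat d d" "Q \<in> carrier_mat d d" "P * Q = 1\<^sub>m d" "Q * P = 1\<^sub>m d"
  shows "invertible_mat P"
  using assms unfolding invertible_mat_def inverts_mat_def by auto

lemma irreps_carrier_mat:
  "\<sigma> \<in> irreps G \<Longrightarrow> g \<in> carrier G \<Longrightarrow> \<sigma> g \<in> carrier_mat (rep_degree G \<sigma>) (rep_degree G \<sigma>)"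
  by (auto simp: irreps_def irreducible_rep_def matrix_rep_def)

lemma rep_equivI:
  assumes "\<sigma> \<in> irreps G" "\<tau> \<in> irreps G" "rep_degree G \<sigma> = rep_degree G \<tau>"
    and "P \<in> carrier_mat (rep_degree G \<sigma>) (rep_degree G \<sigma>)" "invertible_mat P"
    and "\<And>g. g \<in> carrier G \<Longrightarrow> P * \<sigma> g = \<tau> g * P"
  shows "(\<sigma>, \<tau>) \<in> rep_equiv G"
  using assms unfolding rep_equiv_def by blast

lemma rep_equivE:
  assumes "(\<sigma>, \<tau>) \<in> rep_equiv G"
  obtains P where "\<sigma> \<in> irreps G" "\<tau> \<in> irreps G" "rep_degree G \<tau> = rep_degree G \<sigma>"
    and "P \<in> carrier_mat (rep_degree G \<sigma>) (rep_degree G \<sigma>)" "invertible_mat P"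
    and "\<And>g. g \<in> carrier G \<Longrightarrow> P * \<sigma> g = \<tau> g * P"
  using assms unfolding rep_equiv_def by force

lemma equiv_rep_equiv: "equiv (irreps G) (rep_equiv G)"
proof (rule equivI)
  show "rep_equiv G \<subseteq> irreps G \<times> irreps G" by (auto simp: rep_equiv_def)
  show "refl_on (irreps G) (rep_equiv G)"
  proof (rule refl_onI)
    fix \<sigma> assume s: "\<sigma> \<in> irreps G"
    have "invertible_mat (1\<^sub>m (rep_degree G \<sigma>) :: complex mat)"
      by (rule invertible_matI[of _ "rep_degree G \<sigma>" "1\<^sub>m (rep_degree G \<sigma>)"]) auto
    moreover have "1\<^sub>m (rep_degree G \<sigma>) * \<sigma> g = \<sigma> g * 1\<^sub>m (rep_degree G \<sigma>)"
      if "g \<in> carrier G" for g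
      using irreps_carrier_mat[OF s that] by simp
    ultimately show "(\<sigma>, \<sigma>) \<in> rep_equiv G"
      using s by (intro rep_equivI[where P = "1\<^sub>m (rep_degree G \<sigma>)"]) simp_all
  qed
  show "sym (rep_equiv G)"
  proof (rule symI)
    fix \<sigma> \<tau> assume rel: "(\<sigma>, \<tau>) \<in> rep_equiv G"
    obtain P where st: "\<sigma> \<in> irreps G" "\<tau> \<in> irreps G" "rep_degree G \<tau> = rep_degree G \<sigma>"
      and P: "P \<in> carrier_mat (rep_degree G \<sigma>) (rep_degree G \<sigma>)" "invertible_mat P"
        "\<And>g. g \<in> carrier G \<Longrightarrow> P * \<sigma> g = \<tau> g * P"
      by (rule rep_equivE[OF rel]) blast
    let ?d = "rep_degree G \<sigma>"
    obtain Q where Q: "Q \<in> carrier_mat ?d ?d" "P * Q = 1\<^sub>m ?d" "Q * P = 1\<^sub>m ?d"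
      by (rule invertible_matE[OF P(2,1)])
    have "Q * \<tau> g = \<sigma> g * Q" if g: "g \<in> carrier G" for g
    proof -
      have c: "\<sigma> g \<in> carrier_mat ?d ?d" "\<tau> g \<in> carrier_mat ?d ?d"
        using irreps_carrier_mat[OF st(1) g] irreps_carrier_mat[OF st(2) g] st(3) by simp_all
      have "Q * \<tau> g = Q * (\<tau> g * (P * Q))" using c Q by simp
      also have "\<dots> = Q * ((\<tau> g * P) * Q)" using assoc_mult_mat[OF c(2) P(1) Q(1)] by simp
      also have "\<dots> = Q * ((P * \<sigma> g) * Q)" using P(3)[OF g] by simp
      also have "\<dots> = Q * (P * (\<sigma> g * Q))"
        using assoc_mult_mat[OF P(1) c(1) Q(1)] by simp
      also have "\<dots> = (Q * P) * (\<sigma> g * Q)"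
        using assoc_mult_mat[OF Q(1) P(1), of "\<sigma> g * Q" ?d] c(1) Q(1) by simp
      also have "\<dots> = \<sigma> g * Q" using c(1) Q by simp
      finally show ?thesis .
    qed
    moreover have "invertible_mat Q" using invertible_matI[OF Q(1) P(1) Q(3,2)] .
    ultimately show "(\<tau>, \<sigma>) \<in> rep_equiv G" 
      using st Q(1) by (intro rep_equivI[where P = Q]) simp_all
  qed
  show "trans (rep_equiv G)"
  proof (rule transI)
    fix \<sigma> \<tau> \<upsilon> assume rel: "(\<sigma>, \<tau>) \<in> rep_equiv G" "(\<tau>, \<upsilon>) \<in> rep_equiv G"
    obtain P where st: "\<sigma> \<in> irreps G" "\<tau> \<in> irreps G" "rep_degree G \<tau> = rep_degree G \<sigma>"
      and P: "P \<in> carrier_mat (rep_degree G \<sigma>) (rep_degree G \<sigma>)" "invertible_mat P"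
        "\<And>g. g \<in> carrier G \<Longrightarrow> P * \<sigma> g = \<tau> g * P"
      by (rule rep_equivE[OF rel(1)]) blast
    obtain R where tu: "\<upsilon> \<in> irreps G" "rep_degree G \<upsilon> = rep_degree G \<tau>"
      and R: "R \<in> carrier_mat (rep_degree G \<tau>) (rep_degree G \<tau>)" "invertible_mat R"
        "\<And>g. g \<in> carrier G \<Longrightarrow> R * \<tau> g = \<upsilon> g * R"
      by (rule rep_equivE[OF rel(2)]) blast
    note R = R(1)[unfolded st(3)] R(2,3)
    let ?d = "rep_degree G \<sigma>"
    have "(R * P) * \<sigma> g = \<upsilon> g * (R * P)" if g: "g \<in> carrier G" for g
    proof -
      have c: "\<sigma> g \<in> carrier_mat ?d ?d" "\<tau> g \<in> carrier_mat ?d ?d" "\<upsilon> g \<in> carrier_mat ?d ?d"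
        using irreps_carrier_mat[OF st(1) g] irreps_carrier_mat[OF st(2) g]
          irreps_carrier_mat[OF tu(1) g] st(3) tu(2) by simp_all
      have "(R * P) * \<sigma> g = R * (P * \<sigma> g)" using assoc_mult_mat[OF R(1) P(1) c(1)] .
      also have "\<dots> = (R * \<tau> g) * P"
        using P(3)[OF g] assoc_mult_mat[OF R(1) c(2) P(1)] by simp
      also have "\<dots> = \<upsilon> g * (R * P)"
        using R(3)[OF g] assoc_mult_mat[OF c(3) R(1) P(1)] by simp
      finally show ?thesis .
    qed
    moreover have "invertible_mat (R * P)"
    proof -
      obtain P' where P': "P' \<in> carrier_mat ?d ?d" "P * P' = 1\<^sub>m ?d" "P' * P = 1\<^sub>m ?d"
        by (rule invertible_matE[OF P(2,1)])
      obtain R' where R': "R' \<in> carrier_mat ?d ?d" "R * R' = 1\<^sub>m ?d" "R' * R = 1\<^sub>m ?d"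
        by (rule invertible_matE[OF R(2,1)])
      have "(R * P) * (P' * R') = R * ((P * P') * R')"
        using assoc_mult_mat[OF R(1) P(1), of "P' * R'" ?d] assoc_mult_mat[OF P(1) P'(1) R'(1)]
          P'(1) R'(1) by simp
      moreover have "(P' * R') * (R * P) = P' * ((R' * R) * P)"
        using assoc_mult_mat[OF P'(1) R'(1), of "R * P" ?d] assoc_mult_mat[OF R'(1) R(1) P(1)]
          P(1) R(1) by simp
      ultimately show ?thesis
        using P(1) R(1) P' R' by (intro invertible_matI[of _ ?d "P' * R'"]) auto
    qed
    ultimately show "(\<sigma>, \<upsilon>) \<in> rep_equiv G"
      using st tu mult_carrier_mat[OF R(1) P(1)]
      by (intro rep_equivI[where P = "R * P"]) simp_all
  qed
qed

end

(*
  Every element of the block of sigma is F_C(g) = tr(C sigma(g)) for a matrix C, unique by Schur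
  orthogonality. With E the average of sigma over H, the projection sends F_C to F_{CE}, so the
  invariant elements of the block are the F_C with C = CE. The matrix E is idempotent; write
  E = AB with BA = 1_r. Then C = (CA)B, so the space of these C has dimension d * r, and
  r = tr(BA) = tr(E) = m_sigma.

  For the sum, the character of the regular representation is a sum of irreducible characters in
  which, by orthogonality, the class of sigma occurs d_sigma times. Hence
  sum_sigma d_sigma chi_sigma(g) = |G| [g = 1] (so there are finitely many classes), and averaging
  over H gives |G| / |H| = |X|.
*)
theory Submission
  imports Defs "Jordan_Normal_Form.DL_Rank" "Jordan_Normal_Form.Spectral_Radius"
begin

subsection \<open>Traces, subspaces and idempotents\<close>

text \<open>Orthogonality is phrased with \<open>\<sigma> (inv g)\<close> in place of the conjugate
  of \<open>\<sigma> g\<close>: this is what averaging a matrix over the group produces, and the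
  resulting bilinear pairing reads off coefficients directly. The average E stands to the right of C
  because the projection averages left translates: tr(C \<sigma>(h g)) = tr(C \<sigma>(h)
  \<sigma>(g)). The rank r is a natural number while m_sigma is by definition a complex average; the
  trace can identify them because tr(AB) = tr(BA) also holds for rectangular factors. Finiteness of
  the dual has to be settled before the last sum is rearranged, since a sum over an infinite set is
  0 by convention. The multiplicity count supplies it: each class occurs d_sigma > 0 times in one
  finite list.\<close>

lemma index_mult_mat_sum:
  assumes "A \<in> carrier_mat m n" "B \<in> carrier_mat n p" "i < m" "j < p"
  shows "(A * B) $$ (i, j) = (\<Sum>k<n. A $$ (i, k) * B $$ (k, j))"
  using assms by (simp add: scalar_prod_def lessThan_atLeast0)

lemma index_mult_mat_vec_sum:
  assumes "A \<in> carrier_mat m n" "v \<in> carrier_vec n" "i < m"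
  shows "(A *\<^sub>v v) $ i = (\<Sum>k<n. A $$ (i, k) * v $ k)"
  using assms by (simp add: scalar_prod_def lessThan_atLeast0)

lemma mult_mat_zero_vec:
  fixes A :: "'a :: semiring_0 mat"
  shows "A \<in> carrier_mat m n \<Longrightarrow> A *\<^sub>v 0\<^sub>v n = 0\<^sub>v m"
  by (intro eq_vecI) auto

lemma mat_eqI_vec:
  fixes A B :: "'a :: comm_ring_1 mat"
  assumes A: "A \<in> carrier_mat m n" and B: "B \<in> carrier_mat m n"
    and eq: "\<And>v. v \<in> carrier_vec n \<Longrightarrow> A *\<^sub>v v = B *\<^sub>v v"
  shows "A = B"
proof (rule eq_matI)
  fix i j assume "i < dim_row B" "j < dim_col B"
  hence ij: "i < m" "j < n" using B by auto
  have "(A *\<^sub>v unit_vec n j) $ i = (B *\<^sub>v unit_vec n j) $ i" using eq by simp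
  thus "A $$ (i, j) = B $$ (i, j)" using A B ij by simp
qed (use A B in auto)

definition mat_trace :: "'a :: comm_semiring_0 mat \<Rightarrow> 'a"
  where "mat_trace A = (\<Sum>i<dim_row A. A $$ (i, i))"

lemma mat_trace_mult:
  assumes "A \<in> carrier_mat m n" "B \<in> carrier_mat n m"
  shows "mat_trace (A * B) = (\<Sum>i<m. \<Sum>k<n. A $$ (i, k) * B $$ (k, i))"
  using assms unfolding mat_trace_def
  by (simp add: index_mult_mat_sum[OF assms] del: index_mult_mat(1))

text \<open>Both sides sum the same products. The factors may be rectangular, and this is the form
  used later: it turns the trace of an idempotent into its rank, and it forces the degrees in
  Schur's lemma to agree.\<close>

lemma mat_trace_mult_comm:
  assumes "A \<in> carrier_mat m n" "B \<in> carrier_mat n m"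
  shows "mat_trace (A * B) = mat_trace (B * A)"
  unfolding mat_trace_mult[OF assms] mat_trace_mult[OF assms(2,1)]
  by (subst sum.swap) (simp add: mult.commute)

lemma mat_trace_similar:
  fixes A :: "'a :: comm_semiring_1 mat"
  assumes "P \<in> carrier_mat n n" "Q \<in> carrier_mat n n" "A \<in> carrier_mat n n" "P * Q = 1\<^sub>m n"
  shows "mat_trace (Q * A * P) = mat_trace A"
proof -
  have "mat_trace (Q * A * P) = mat_trace (P * (Q * A))"
    using assms by (intro mat_trace_mult_comm) auto
  also have "P * (Q * A) = A"
    using assms by (simp add: assoc_mult_mat[of P n n Q n A n, symmetric] left_mult_one_mat[of A n n])
  finally show ?thesis .
qed

section \<open>Subspaces of coordinate space and bases adapted to them\<close>

lemma subspace_vecI: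
  fixes W :: "'a :: field vec set"
  assumes "W \<subseteq> carrier_vec n" "0\<^sub>v n \<in> W"
    and "\<And>v w. v \<in> W \<Longrightarrow> w \<in> W \<Longrightarrow> v + w \<in> W"
    and "\<And>c v. v \<in> W \<Longrightarrow> c \<cdot>\<^sub>v v \<in> W"
  shows "VectorSpace.subspace class_ring W (module_vec TYPE('a) n)"
  unfolding VectorSpace.subspace_def LinearCombinations.submodule_def
  using assms vec_module[where 'a = 'a and n = n] vec_vs[where 'a = 'a and n = n]
  by (auto simp: module_vec_simps)

lemma subspace_vecD:
  fixes W :: "'a :: field vec set"
  assumes "VectorSpace.subspace class_ring W (module_vec TYPE('a) n)"
  shows "W \<subseteq> carrier_vec n" "0\<^sub>v n \<in> W"
    and "\<And>v w. v \<in> W \<Longrightarrow> w \<in> W \<Longrightarrow> v + w \<in> W"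
    and "\<And>c v. v \<in> W \<Longrightarrow> c \<cdot>\<^sub>v v \<in> W"
  using assms unfolding VectorSpace.subspace_def LinearCombinations.submodule_def
  by (auto simp: module_vec_simps)

text \<open>The first \<open>r\<close> columns of \<open>P\<close> are a basis of \<open>W\<close>.\<close>

lemma adapted_basis:
  fixes W :: "'a :: field vec set"
  assumes "VectorSpace.subspace class_ring W (module_vec TYPE('a) d)"
  obtains r P Q where "r \<le> d" "P \<in> carrier_mat d d" "Q \<in> carrier_mat d d"
    "P * Q = 1\<^sub>m d" "Q * P = 1\<^sub>m d"
    "\<And>v. v \<in> carrier_vec d \<Longrightarrow> P *\<^sub>v v \<in> W \<longleftrightarrow> (\<forall>i<d. r \<le> i \<longrightarrow> v $ i = 0)"
proof -
  interpret vec_space "TYPE('a)" d .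
  have WV: "W \<subseteq> carrier_vec d" using subspace_vecD(1)[OF assms] .
  have sub: "LinearCombinations.submodule class_ring W V"
    using assms unfolding VectorSpace.subspace_def by blast
  have empty: "lin_indpt {}" unfolding lin_dep_def by auto
  \<comment> \<open>The dimension bounds the size of independent sets, so a maximal independent
    subset of \<open>W\<close> exists. It spans \<open>W\<close>, because a vector outside its span
    could be added to it.\<close>
  obtain B where B: "finite B" "maximal B (\<lambda>S. S \<subseteq> W \<and> lin_indpt S)"
  proof -
    have "finite S \<and> card S \<le> dim" if "S \<subseteq> W \<and> lin_indpt S" for S
      using li_le_dim[OF fin_dim, of S] subset_trans[OF _ WV, of S] that by simp
    from maximal_exists[of "\<lambda>S. S \<subseteq> W \<and> lin_indpt S", OF this, of "{}"] empty that
    show thesis by blast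
  qed
  have BW: "B \<subseteq> W" and Bi: "lin_indpt B" using B(2) unfolding maximal_def by auto
  have Bmax: "S = B" if "B \<subseteq> S" "S \<subseteq> W" "lin_indpt S" for S
    using B(2) that unfolding maximal_def by blast
  have "span B = W"
  proof
    show "span B \<subseteq> W" using span_is_subset[OF BW sub] .
    show "W \<subseteq> span B"
    proof
      fix w assume w: "w \<in> W"
      show "w \<in> span B"
      proof (rule ccontr)
        assume n: "w \<notin> span B"
        hence "w \<notin> B" using BW WV span_mem[of B w] by blast
        hence "lin_indpt (B \<union> {w})"
          using lin_dep_iff_in_span[of B w] n BW WV Bi w by auto
        hence "B \<union> {w} = B" using Bmax BW w by blast
        thus False using \<open>w \<notin> B\<close> by blast
      qed
    qed
  qed
  obtain C where C: "finite C" "maximal C (\<lambda>S. B \<subseteq> S \<and> S \<subseteq> carrier_vec d \<and> lin_indpt S)"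
  proof -
    have "finite S \<and> card S \<le> dim" if "B \<subseteq> S \<and> S \<subseteq> carrier_vec d \<and> lin_indpt S" for S
      using li_le_dim[OF fin_dim, of S] that by simp
    from maximal_exists[of "\<lambda>S. B \<subseteq> S \<and> S \<subseteq> carrier_vec d \<and> lin_indpt S", OF this, of B] BW WV Bi that
    show thesis by blast
  qed
  have CB: "B \<subseteq> C" "C \<subseteq> carrier_vec d" "lin_indpt C" using C(2) unfolding maximal_def by auto
  have "S = C" if "C \<subseteq> S" "S \<subseteq> carrier_vec d" "lin_indpt S" for S
  proof -
    have "B \<subseteq> S" using CB(1) that(1) by (rule subset_trans)
    thus ?thesis using C(2) that unfolding maximal_def by blast
  qed
  \<comment> \<open>Every independent set above \<open>C\<close> also contains \<open>B\<close>, so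
    maximality among the supersets of \<open>B\<close> is maximality outright, and \<open>C\<close>
    is a basis of the whole space.\<close>
  hence "maximal C (\<lambda>S. S \<subseteq> carrier V \<and> lin_indpt S)"
    using CB unfolding maximal_def cV by blast
  hence "basis C" using max_li_is_basis by simp
  hence cardC: "card C = d" using dim_basis[OF C(1)] dim_is_n by simp
  obtain bs where bs: "set bs = B" "distinct bs" using finite_distinct_list[OF B(1)] by blast
  obtain cs where cs: "set cs = C - B" "distinct cs"
    using finite_distinct_list[of "C - B"] C(1) by blast
  \<comment> \<open>The vectors of \<open>B\<close> come first, so that they become the columns of
    \<open>P\<close> with index below \<open>r\<close>.\<close>
  define xs where "xs = bs @ cs"
  have xs: "set xs = C" "distinct xs" "length xs = d"
  proof -
    show x: "set xs = C" "distinct xs" using bs cs CB by (auto simp: xs_def)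
    show "length xs = d" using distinct_card[OF x(2)] x(1) cardC by simp
  qed
  define r where "r = length bs"
  define P where "P = mat_of_cols d xs"
  have P: "P \<in> carrier_mat d d" unfolding P_def using xs by auto
  have colsP: "cols P = xs" unfolding P_def using xs CB by (intro cols_mat_of_cols) auto
  have "rank P = d" using lin_indpt_full_rank[OF P] colsP xs CB by simp
  hence "det P \<noteq> 0" using det_rank_iff[OF P] by simp
  from det_non_zero_imp_unit[OF P this, of "()"]
  obtain Q where Q: "Q \<in> carrier_mat d d" "P * Q = 1\<^sub>m d" "Q * P = 1\<^sub>m d"
    unfolding Units_def by (auto simp: ring_mat_def)
  have rd: "r \<le> d" using xs by (auto simp: xs_def r_def)
  \<comment> \<open>On a vector padded with zeros, \<open>P\<close> acts through its first
    \<open>r\<close> columns alone. Hence \<open>W\<close>, the image of \<open>?A\<close>, is the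
    image under \<open>P\<close> of the vectors supported on the first \<open>r\<close>
    coordinates.\<close>
  let ?A = "mat_of_cols d bs"
  let ?ext = "\<lambda>u. vec d (\<lambda>i. if i < r then u $ i else 0)"
  have A: "?A \<in> carrier_mat d r" by (simp add: r_def)
  have Pext: "P *\<^sub>v ?ext u = ?A *\<^sub>v u" if u: "u \<in> carrier_vec r" for u
  proof (rule eq_vecI)
    fix i assume "i < dim_vec (?A *\<^sub>v u)"
    hence i: "i < d" by simp
    have "(P *\<^sub>v ?ext u) $ i = (\<Sum>k<d. P $$ (i, k) * ?ext u $ k)"
      by (rule index_mult_mat_vec_sum[OF P _ i]) simp
    also have "\<dots> = (\<Sum>k<r. P $$ (i, k) * u $ k)"
      using rd by (intro sum.mono_neutral_cong_right) auto
    also have "\<dots> = (\<Sum>k<r. ?A $$ (i, k) * u $ k)"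
    proof (rule sum.cong)
      fix k assume "k \<in> {..<r}"
      hence "k < r" by simp
      hence "P $$ (i, k) = ?A $$ (i, k)"
        using i rd unfolding P_def
        by (simp add: mat_of_cols_def xs nth_append xs_def r_def)
      thus "P $$ (i, k) * u $ k = ?A $$ (i, k) * u $ k" by simp
    qed simp
    also have "\<dots> = (?A *\<^sub>v u) $ i" by (rule index_mult_mat_vec_sum[OF A u i, symmetric])
    finally show "(P *\<^sub>v ?ext u) $ i = (?A *\<^sub>v u) $ i" .
  qed (use P in simp)
  have bsd: "\<forall>w\<in>set bs. dim_vec w = d" using bs BW WV by auto
  have W_iff: "w \<in> W \<longleftrightarrow> (\<exists>u\<in>carrier_vec r. w = ?A *\<^sub>v u)" for w
  proof -
    have "W = span_list bs"
      using \<open>span B = W\<close> bs(1) BW WV by (subst span_list_as_span) auto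
    hence "w \<in> W \<longleftrightarrow> (\<exists>c. w = lincomb_list c bs)" by (auto simp: span_list_def)
    also have "\<dots> \<longleftrightarrow> (\<exists>c. w = ?A *\<^sub>v vec r c)"
      using lincomb_list_as_mat_mult[OF bsd] by (simp add: r_def)
    also have "\<dots> \<longleftrightarrow> (\<exists>u\<in>carrier_vec r. w = ?A *\<^sub>v u)"
    proof
      assume "\<exists>u\<in>carrier_vec r. w = ?A *\<^sub>v u"
      then obtain u where "u \<in> carrier_vec r" "w = ?A *\<^sub>v u" by blast
      moreover have "vec r (($) u) = u" using calculation by auto
      ultimately show "\<exists>c. w = ?A *\<^sub>v vec r c" by metis
    qed auto
    finally show ?thesis .
  qed
  have "P *\<^sub>v v \<in> W \<longleftrightarrow> (\<forall>i<d. r \<le> i \<longrightarrow> v $ i = 0)" if v: "v \<in> carrier_vec d" for v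
  proof
    assume "P *\<^sub>v v \<in> W"
    then obtain u where u: "u \<in> carrier_vec r" "P *\<^sub>v v = ?A *\<^sub>v u" using W_iff by blast
    have "v = Q *\<^sub>v (P *\<^sub>v v)" using P Q v by (simp flip: assoc_mult_mat_vec)
    also have "\<dots> = Q *\<^sub>v (P *\<^sub>v ?ext u)" using u Pext by simp
    also have "\<dots> = ?ext u" using P Q by (simp flip: assoc_mult_mat_vec)
    finally have "v = ?ext u" .
    thus "\<forall>i<d. r \<le> i \<longrightarrow> v $ i = 0" by simp
  next
    assume z: "\<forall>i<d. r \<le> i \<longrightarrow> v $ i = 0"
    have "v = ?ext (vec r (($) v))" using v z rd by (intro eq_vecI) auto
    hence "P *\<^sub>v v = ?A *\<^sub>v vec r (($) v)" using Pext[of "vec r (($) v)"] by simp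
    thus "P *\<^sub>v v \<in> W" using W_iff by auto
  qed
  thus thesis using that rd P Q by blast
qed

text \<open>A full rank factorization, built in a basis adapted to the fixed space of
  \<open>E\<close>. The columns of \<open>E\<close> are fixed by \<open>E\<close>, so in adapted
  coordinates \<open>Q * E\<close> has zero rows from index \<open>r\<close> on. Dropping these
  rows, and the matching columns of \<open>P\<close>, loses nothing in the product P (Q E) =
  E.\<close>

lemma idempotent_factorization:
  fixes E :: "'a :: field mat"
  assumes E: "E \<in> carrier_mat d d" and idem: "E * E = E"
  obtains r A B where "A \<in> carrier_mat d r" "B \<in> carrier_mat r d" "A * B = E" "B * A = 1\<^sub>m r"
proof -
  let ?W = "{v \<in> carrier_vec d. E *\<^sub>v v = v}"
  have "VectorSpace.subspace class_ring ?W (module_vec TYPE('a) d)"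
    using E by (intro subspace_vecI) (auto simp: mult_add_distrib_mat_vec mult_mat_vec)
  then obtain r P Q where r: "r \<le> d" and P: "P \<in> carrier_mat d d" and Q: "Q \<in> carrier_mat d d"
    and PQ: "P * Q = 1\<^sub>m d" "Q * P = 1\<^sub>m d"
    and mem: "\<And>v. v \<in> carrier_vec d \<Longrightarrow> P *\<^sub>v v \<in> ?W \<longleftrightarrow> (\<forall>i<d. r \<le> i \<longrightarrow> v $ i = 0)"
    by (rule adapted_basis) blast
  define A where "A = mat d r (\<lambda>(i, j). P $$ (i, j))"
  define B where "B = mat r d (\<lambda>(i, j). (Q * E) $$ (i, j))"
  have A: "A \<in> carrier_mat d r" and B: "B \<in> carrier_mat r d" by (simp_all add: A_def B_def)
  have QE: "Q * E \<in> carrier_mat d d" using Q E by simp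
  have PQE: "P * (Q * E) = E" using P Q E PQ by (simp flip: assoc_mult_mat[of P d d Q d])
  have zero: "(Q * E) $$ (i, j) = 0" if "i < d" "r \<le> i" "j < d" for i j
  proof -
    have c: "col (Q * E) j \<in> carrier_vec d" using QE by (auto simp: carrier_vecI)
    have "P *\<^sub>v col (Q * E) j = col E j"
      using PQE col_mult2[OF P QE that(3)] by simp
    moreover have "E *\<^sub>v col E j = col E j"
      using idem col_mult2[OF E E that(3)] by simp
    moreover have "col E j \<in> carrier_vec d" using E by (intro carrier_vecI) simp
    ultimately have "P *\<^sub>v col (Q * E) j \<in> ?W" by simp
    hence "col (Q * E) j $ i = 0" using mem[OF c] that by blast
    thus ?thesis using that carrier_matD[OF QE] by (simp only: index_col)
  qed
  have AB: "A * B = E"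
  proof (rule eq_matI)
    fix i j assume "i < dim_row E" "j < dim_col E"
    hence ij: "i < d" "j < d" using E by auto
    have "E $$ (i, j) = (P * (Q * E)) $$ (i, j)" using PQE by simp
    also have "\<dots> = (\<Sum>k<d. P $$ (i, k) * (Q * E) $$ (k, j))"
      by (rule index_mult_mat_sum[OF P QE ij])
    also have "\<dots> = (\<Sum>k<r. A $$ (i, k) * B $$ (k, j))"
      using r ij zero by (intro sum.mono_neutral_cong_right) (auto simp: A_def B_def)
    also have "\<dots> = (A * B) $$ (i, j)" by (rule index_mult_mat_sum[OF A B ij, symmetric])
    finally show "(A * B) $$ (i, j) = E $$ (i, j)" by simp
  qed (use E A B in auto)
  have "B * A = 1\<^sub>m r"
  proof (rule eq_matI)
    fix i j assume "i < dim_row (1\<^sub>m r :: 'a mat)" "j < dim_col (1\<^sub>m r :: 'a mat)"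
    hence ij: "i < r" "j < r" by auto
    hence ijd: "i < d" "j < d" using r by auto
    have cP: "col P j = P *\<^sub>v unit_vec d j" using P ijd
      by (metis col_mult2 one_carrier_mat col_one right_mult_one_mat)
    \<comment> \<open>The first \<open>r\<close> columns of \<open>P\<close> lie in the fixed space,
      so there \<open>Q * E * P\<close> agrees with \<open>Q * P\<close>, the identity. This yields
      \<open>B * A\<close>.\<close>
    have "col P j \<in> ?W"
      unfolding cP by (subst mem) (use ij ijd in auto)
    hence EP: "E *\<^sub>v col P j = col P j" by simp
    have "col (Q * E * P) j = Q *\<^sub>v (E *\<^sub>v col P j)"
      using ijd P Q E by (subst col_mult2[of _ d d _ d]) auto
    also have "\<dots> = col (Q * P) j" using EP col_mult2[OF Q P ijd(2)] by simp
    finally have eq: "col (Q * E * P) j = col (1\<^sub>m d) j" using PQ by simp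
    have "(B * A) $$ (i, j) = (\<Sum>k<d. B $$ (i, k) * A $$ (k, j))"
      by (rule index_mult_mat_sum[OF B A ij])
    also have "\<dots> = (\<Sum>k<d. (Q * E) $$ (i, k) * P $$ (k, j))"
      using ij by (simp add: A_def B_def)
    also have "\<dots> = (Q * E * P) $$ (i, j)"
      by (rule index_mult_mat_sum[OF QE P ijd, symmetric])
    also have "\<dots> = col (Q * E * P) j $ i" using ijd Q E P by simp
    also have "\<dots> = 1\<^sub>m r $$ (i, j)" using ij ijd by (simp add: eq)
    finally show "(B * A) $$ (i, j) = 1\<^sub>m r $$ (i, j)" .
  qed (use A B in auto)
  with A B AB show thesis by (rule that)
qed

subsection \<open>Characters as sums of irreducible characters\<close>

lemma rep_degree_eq: "matrix_rep G d \<sigma> \<Longrightarrow> rep_degree G \<sigma> = d"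
  by (simp add: matrix_rep_def rep_degree_def)

lemma matrix_repD:
  assumes "matrix_rep G d \<sigma>"
  shows "g \<in> carrier G \<Longrightarrow> \<sigma> g \<in> carrier_mat d d"
    and "g \<in> carrier G \<Longrightarrow> h \<in> carrier G \<Longrightarrow> \<sigma> (g \<otimes>\<^bsub>G\<^esub> h) = \<sigma> g * \<sigma> h"
    and "\<sigma> \<one>\<^bsub>G\<^esub> = 1\<^sub>m d"
  using assms unfolding matrix_rep_def by auto

lemma irrepsD:
  assumes "\<sigma> \<in> irreps G"
  shows "matrix_rep G (rep_degree G \<sigma>) \<sigma>" "rep_degree G \<sigma> > 0"
    and "\<And>W. VectorSpace.subspace class_ring W (module_vec TYPE(complex) (rep_degree G \<sigma>)) \<Longrightarrow>
      (\<And>g w. g \<in> carrier G \<Longrightarrow> w \<in> W \<Longrightarrow> \<sigma> g *\<^sub>v w \<in> W) \<Longrightarrow>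
      W = {0\<^sub>v (rep_degree G \<sigma>)} \<or> W = carrier_vec (rep_degree G \<sigma>)"
  using assms unfolding irreps_def irreducible_rep_def by blast+

lemma character_eq_mat_trace: "character \<sigma> g = mat_trace (\<sigma> g)"
  by (simp add: character_def mat_trace_def)

lemma sum_lessThan_split:
  fixes f :: "nat \<Rightarrow> 'a :: comm_monoid_add"
  assumes "r \<le> d"
  shows "(\<Sum>k<d. f k) = (\<Sum>k<r. f k) + (\<Sum>k<d - r. f (k + r))"
proof -
  have "(\<Sum>k<d. f k) = (\<Sum>k=0..<r. f k) + (\<Sum>k=r..<d. f k)"
    using assms by (simp add: lessThan_atLeast0 sum.atLeastLessThan_concat)
  also have "(\<Sum>k=r..<d. f k) = (\<Sum>k=0..<d-r. f (k + r))"
    using sum.shift_bounds_nat_ivl[of f 0 r "d - r"] assms by simp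
  finally show ?thesis by (simp add: lessThan_atLeast0)
qed

text \<open>
  An invariant subspace makes the representation block triangular in an adapted basis; the two
  diagonal blocks are representations, and no invariant complement is needed for the characters.
\<close>

lemma character_split:
  assumes rep: "matrix_rep G d \<tau>" and "d > 0" and red: "\<tau> \<notin> irreps G"
  obtains r s \<alpha> \<delta> where "r < d" "s < d" "matrix_rep G r \<alpha>" "matrix_rep G s \<delta>"
    "\<And>g. g \<in> carrier G \<Longrightarrow> character \<tau> g = character \<alpha> g + character \<delta> g"
proof -
  obtain W where W: "VectorSpace.subspace class_ring W (module_vec TYPE(complex) d)"
    and inv: "\<And>g w. g \<in> carrier G \<Longrightarrow> w \<in> W \<Longrightarrow> \<tau> g *\<^sub>v w \<in> W"
    and nz: "W \<noteq> {0\<^sub>v d}" "W \<noteq> carrier_vec d"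
  proof -
    have deg: "rep_degree G \<tau> = d" using rep_degree_eq[OF rep] .
    have "\<not> (\<forall>W. VectorSpace.subspace class_ring W (module_vec TYPE(complex) d) \<and>
        (\<forall>g\<in>carrier G. \<forall>w\<in>W. \<tau> g *\<^sub>v w \<in> W) \<longrightarrow> W = {0\<^sub>v d} \<or> W = carrier_vec d)"
      using red rep \<open>d > 0\<close> unfolding irreps_def irreducible_rep_def mem_Collect_eq deg by simp
    thus thesis using that by blast
  qed
  obtain r P Q where r: "r \<le> d" and P: "P \<in> carrier_mat d d" and Q: "Q \<in> carrier_mat d d"
    and PQ: "P * Q = 1\<^sub>m d" "Q * P = 1\<^sub>m d"
    and mem: "\<And>v. v \<in> carrier_vec d \<Longrightarrow> P *\<^sub>v v \<in> W \<longleftrightarrow> (\<forall>i<d. r \<le> i \<longrightarrow> v $ i = 0)"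
    using adapted_basis[OF W] by blast
  have PQv: "P *\<^sub>v (Q *\<^sub>v w) = w" if "w \<in> carrier_vec d" for w
    using that P Q PQ by (simp flip: assoc_mult_mat_vec)
  have WV: "W \<subseteq> carrier_vec d" "0\<^sub>v d \<in> W" using subspace_vecD[OF W] by auto
  \<comment> \<open>Both diagonal blocks must be strictly smaller than \<open>d\<close> for the
    later induction on the degree. The value \<open>r = d\<close> would make \<open>W\<close> the
    whole space, and \<open>r = 0\<close> would make it zero.\<close>
  have "r \<noteq> d"
  proof
    assume "r = d"
    have "w \<in> W" if w: "w \<in> carrier_vec d" for w
      using mem[of "Q *\<^sub>v w"] PQv[OF w] Q w \<open>r = d\<close> by simp
    thus False using nz(2) WV(1) by blast
  qed
  hence rd: "r < d" using r by simp
  have "r \<noteq> 0"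
  proof
    assume "r = 0"
    have "w = 0\<^sub>v d" if w: "w \<in> W" for w
    proof -
      have wd: "w \<in> carrier_vec d" using w WV by blast
      have "\<forall>i<d. (Q *\<^sub>v w) $ i = 0"
        using mem[of "Q *\<^sub>v w"] PQv[OF wd] Q w wd \<open>r = 0\<close> by (simp del: index_mult_mat_vec)
      hence "Q *\<^sub>v w = 0\<^sub>v d" using Q by (intro eq_vecI) (simp_all del: index_mult_mat_vec(1))
      thus ?thesis using PQv[OF wd] mult_mat_zero_vec[OF P] by simp
    qed
    thus False using nz(1) WV(2) by blast
  qed
  hence sd: "d - r < d" using rd by simp
  define M where "M g = Q * \<tau> g * P" for g
  note T = matrix_repD[OF rep]
  have M: "M g \<in> carrier_mat d d" if "g \<in> carrier G" for g
    using T(1)[OF that] P Q by (simp add: M_def)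
  have M_one: "M \<one>\<^bsub>G\<^esub> = 1\<^sub>m d" using T(3) P Q PQ by (simp add: M_def)
  have M_mult: "M (g \<otimes>\<^bsub>G\<^esub> h) = M g * M h" if g: "g \<in> carrier G" and h: "h \<in> carrier G" for g h
  proof -
    note c = T(1)[OF g] T(1)[OF h] P Q
    have "M g * M h = Q * \<tau> g * (P * Q) * (\<tau> h * P)"
      unfolding M_def using c by (simp add: assoc_mult_mat[of _ d d _ d _ d])
    thus ?thesis unfolding M_def T(2)[OF g h] PQ(1) using c
      by (simp add: assoc_mult_mat[of _ d d _ d _ d])
  qed
  \<comment> \<open>The first \<open>r\<close> basis vectors span \<open>W\<close>, and
    \<open>W\<close> is invariant, so their images have no coordinates from \<open>r\<close> on: the
    lower left block vanishes.\<close>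
  have M_zero: "M g $$ (i, j) = 0" if g: "g \<in> carrier G" and ij: "i < d" "r \<le> i" "j < r" for g i j
  proof -
    have j: "j < d" using ij r by simp
    let ?e = "unit_vec d j :: complex vec"
    have "P *\<^sub>v ?e \<in> W" using mem[of ?e] ij by simp
    hence "\<tau> g *\<^sub>v (P *\<^sub>v ?e) \<in> W" using inv g by blast
    moreover have "P *\<^sub>v (M g *\<^sub>v ?e) = \<tau> g *\<^sub>v (P *\<^sub>v ?e)"
    proof -
      have "P * M g = \<tau> g * P"
        using assoc_mult_mat[OF Q T(1)[OF g] P] assoc_mult_mat[OF P Q, of "\<tau> g * P" d]
          left_mult_one_mat[of "\<tau> g * P" d d] T(1)[OF g] P PQ by (simp add: M_def)
      thus ?thesis using assoc_mult_mat_vec[OF P M[OF g], of ?e]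
          assoc_mult_mat_vec[OF T(1)[OF g] P, of ?e] by simp
    qed
    ultimately have "(M g *\<^sub>v ?e) $ i = 0" using mem[of "M g *\<^sub>v ?e"] M[OF g] ij by auto
    moreover have "(M g *\<^sub>v ?e) $ i = M g $$ (i, j)"
      using M[OF g] ij j by simp
    ultimately show ?thesis by simp
  qed
  define \<alpha> where "\<alpha> g = mat r r (\<lambda>(i, j). M g $$ (i, j))" for g
  define \<delta> where "\<delta> g = mat (d - r) (d - r) (\<lambda>(i, j). M g $$ (i + r, j + r))" for g
  have \<alpha>: "\<alpha> g \<in> carrier_mat r r" and \<delta>: "\<delta> g \<in> carrier_mat (d - r) (d - r)" for g
    by (simp_all add: \<alpha>_def \<delta>_def)
  have M_sum: "M (g \<otimes>\<^bsub>G\<^esub> h) $$ (i, j)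
      = (\<Sum>k<r. M g $$ (i, k) * M h $$ (k, j)) + (\<Sum>k<d - r. M g $$ (i, k + r) * M h $$ (k + r, j))"
    if "g \<in> carrier G" "h \<in> carrier G" "i < d" "j < d" for g h i j
    unfolding M_mult[OF that(1,2)] index_mult_mat_sum[OF M[OF that(1)] M[OF that(2)] that(3,4)]
    by (rule sum_lessThan_split[OF r])
  have "matrix_rep G r \<alpha>"
    unfolding matrix_rep_def
  proof (intro conjI ballI \<alpha>)
    show "\<alpha> \<one>\<^bsub>G\<^esub> = 1\<^sub>m r" using r by (intro eq_matI) (auto simp: \<alpha>_def M_one)
    fix g h assume g: "g \<in> carrier G" and h: "h \<in> carrier G"
    show "\<alpha> (g \<otimes>\<^bsub>G\<^esub> h) = \<alpha> g * \<alpha> h"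
    proof (rule eq_matI)
      fix i j assume "i < dim_row (\<alpha> g * \<alpha> h)" "j < dim_col (\<alpha> g * \<alpha> h)"
      hence ij: "i < r" "j < r" by (auto simp: \<alpha>_def)
      \<comment> \<open>Each mixed term has a factor in the vanishing lower left block, here from
        \<open>M h\<close>; for the other diagonal block the factor comes from \<open>M g\<close>.
        So both blocks multiply separately.\<close>
      have "(\<Sum>k<d - r. M g $$ (i, k + r) * M h $$ (k + r, j)) = 0"
        using M_zero[OF h] ij by (intro sum.neutral) auto
      hence "M (g \<otimes>\<^bsub>G\<^esub> h) $$ (i, j) = (\<Sum>k<r. \<alpha> g $$ (i, k) * \<alpha> h $$ (k, j))"
        using M_sum[OF g h, of i j] ij r by (simp add: \<alpha>_def)
      thus "\<alpha> (g \<otimes>\<^bsub>G\<^esub> h) $$ (i, j) = (\<alpha> g * \<alpha> h) $$ (i, j)"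
        unfolding index_mult_mat_sum[OF \<alpha> \<alpha> ij] using ij by (simp add: \<alpha>_def)
    qed (simp_all add: \<alpha>_def)
  qed
  moreover have "matrix_rep G (d - r) \<delta>"
    unfolding matrix_rep_def
  proof (intro conjI ballI \<delta>)
    show "\<delta> \<one>\<^bsub>G\<^esub> = 1\<^sub>m (d - r)" using r by (intro eq_matI) (auto simp: \<delta>_def M_one)
    fix g h assume g: "g \<in> carrier G" and h: "h \<in> carrier G"
    show "\<delta> (g \<otimes>\<^bsub>G\<^esub> h) = \<delta> g * \<delta> h"
    proof (rule eq_matI)
      fix i j assume "i < dim_row (\<delta> g * \<delta> h)" "j < dim_col (\<delta> g * \<delta> h)"
      hence ij: "i < d - r" "j < d - r" by (auto simp: \<delta>_def)
      have "(\<Sum>k<r. M g $$ (i + r, k) * M h $$ (k, j + r)) = 0"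
        using M_zero[OF g] ij by (intro sum.neutral) auto
      hence "M (g \<otimes>\<^bsub>G\<^esub> h) $$ (i + r, j + r) = (\<Sum>k<d - r. \<delta> g $$ (i, k) * \<delta> h $$ (k, j))"
        using M_sum[OF g h, of "i + r" "j + r"] ij r by (simp add: \<delta>_def)
      thus "\<delta> (g \<otimes>\<^bsub>G\<^esub> h) $$ (i, j) = (\<delta> g * \<delta> h) $$ (i, j)"
        unfolding index_mult_mat_sum[OF \<delta> \<delta> ij] using ij by (simp add: \<delta>_def)
    qed (simp_all add: \<delta>_def)
  qed
  moreover have "character \<tau> g = character \<alpha> g + character \<delta> g" if g: "g \<in> carrier G" for g
  proof -
    have "character \<tau> g = mat_trace (M g)"
      unfolding M_def character_eq_mat_trace
      using mat_trace_similar[OF P Q T(1)[OF g] PQ(1)] by simp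
    also have "\<dots> = (\<Sum>i<d. M g $$ (i, i))" using M[OF g] by (simp add: mat_trace_def)
    also have "\<dots> = (\<Sum>i<r. M g $$ (i, i)) + (\<Sum>i<d - r. M g $$ (i + r, i + r))"
      by (rule sum_lessThan_split[OF r])
    also have "\<dots> = character \<alpha> g + character \<delta> g"
      by (simp add: character_def \<alpha>_def \<delta>_def)
    finally show ?thesis .
  qed
  ultimately show thesis using that rd sd by blast
qed

text \<open>Strong induction on the degree, splitting a reducible representation into its two
  diagonal blocks; degree 0 gives the empty list. A list is used instead of a set because an
  irreducible may occur repeatedly, and these occurrences are counted later.\<close>

lemma character_eq_sum_irreps:
  assumes "matrix_rep G d \<tau>"
  shows "\<exists>\<sigma>s. set \<sigma>s \<subseteq> irreps G \<and>
    (\<forall>g\<in>carrier G. character \<tau> g = (\<Sum>\<sigma>\<leftarrow>\<sigma>s. character \<sigma> g))"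
  using assms
proof (induction d arbitrary: \<tau> rule: less_induct)
  case (less d)
  consider "d = 0" | "\<tau> \<in> irreps G" | "d > 0" "\<tau> \<notin> irreps G" by blast
  thus ?case
  proof cases
    case 1
    hence "character \<tau> g = 0" if "g \<in> carrier G" for g
      using matrix_repD(1)[OF less.prems that] by (simp add: character_def)
    thus ?thesis by (intro exI[of _ "[]"]) simp
  next
    case 2
    thus ?thesis by (intro exI[of _ "[\<tau>]"]) simp
  next
    case 3
    obtain r s \<alpha> \<delta> where *: "r < d" "s < d" "matrix_rep G r \<alpha>" "matrix_rep G s \<delta>"
      and sum: "\<And>g. g \<in> carrier G \<Longrightarrow> character \<tau> g = character \<alpha> g + character \<delta> g"
      using character_split[OF less.prems 3] by metis
    obtain as bs where "set as \<subseteq> irreps G" "set bs \<subseteq> irreps G"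
      "\<forall>g\<in>carrier G. character \<alpha> g = (\<Sum>\<sigma>\<leftarrow>as. character \<sigma> g)"
      "\<forall>g\<in>carrier G. character \<delta> g = (\<Sum>\<sigma>\<leftarrow>bs. character \<sigma> g)"
      using less.IH[OF *(1,3)] less.IH[OF *(2,4)] by blast
    thus ?thesis using sum by (intro exI[of _ "as @ bs"]) auto
  qed
qed

subsection \<open>Schur's lemma and orthogonality\<close>

text \<open>Kernel and image of an intertwiner are invariant subspaces, so irreducibility makes a
  nonzero intertwiner injective and surjective. A two-sided inverse is then built by hand, and it
  yields the equality of the degrees.\<close>

lemma schur_invertible:
  assumes \<sigma>: "\<sigma> \<in> irreps G" and \<tau>: "\<tau> \<in> irreps G"
    and P: "P \<in> carrier_mat (rep_degree G \<tau>) (rep_degree G \<sigma>)"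
    and comm: "\<And>g. g \<in> carrier G \<Longrightarrow> P * \<sigma> g = \<tau> g * P"
    and nz: "P \<noteq> 0\<^sub>m (rep_degree G \<tau>) (rep_degree G \<sigma>)"
  shows "rep_degree G \<sigma> = rep_degree G \<tau> \<and> invertible_mat P"
proof -
  define m n where "m = rep_degree G \<sigma>" and "n = rep_degree G \<tau>"
  note P = P[folded m_def n_def] and nz = nz[folded m_def n_def]
  note S = matrix_repD[OF irrepsD(1)[OF \<sigma>], folded m_def]
  note T = matrix_repD[OF irrepsD(1)[OF \<tau>], folded n_def]
  have commv: "P *\<^sub>v (\<sigma> g *\<^sub>v v) = \<tau> g *\<^sub>v (P *\<^sub>v v)" if "g \<in> carrier G" "v \<in> carrier_vec m" for g v
    using assoc_mult_mat_vec[OF P S(1)[OF that(1)] that(2)]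
      assoc_mult_mat_vec[OF T(1)[OF that(1)] P that(2)] comm[OF that(1)] by simp
  let ?K = "{v \<in> carrier_vec m. P *\<^sub>v v = 0\<^sub>v n}"
  let ?I = "(\<lambda>v. P *\<^sub>v v) ` carrier_vec m"
  have "?K = {0\<^sub>v m} \<or> ?K = carrier_vec m"
    unfolding m_def
  proof (rule irrepsD(3)[OF \<sigma>], fold m_def)
    show "VectorSpace.subspace class_ring ?K (module_vec TYPE(complex) m)"
      using P by (intro subspace_vecI) (auto simp: mult_add_distrib_mat_vec mult_mat_vec)
    show "\<sigma> g *\<^sub>v w \<in> ?K" if "g \<in> carrier G" "w \<in> ?K" for g w
      using that commv[of g w] S(1)[of g] T(1)[of g] by auto
  qed
  moreover have "?K \<noteq> carrier_vec m"
  proof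
    assume all: "?K = carrier_vec m"
    have "P *\<^sub>v v = 0\<^sub>v n" if "v \<in> carrier_vec m" for v using that all by blast
    hence "P = 0\<^sub>m n m" using P by (intro mat_eqI_vec[of _ n m]) auto
    thus False using nz by simp
  qed
  ultimately have ker: "v = 0\<^sub>v m" if "v \<in> carrier_vec m" "P *\<^sub>v v = 0\<^sub>v n" for v
    using that by blast
  have "?I = {0\<^sub>v n} \<or> ?I = carrier_vec n"
    unfolding n_def
  proof (rule irrepsD(3)[OF \<tau>], fold n_def)
    show "VectorSpace.subspace class_ring ?I (module_vec TYPE(complex) n)"
    proof (rule subspace_vecI)
      show "?I \<subseteq> carrier_vec n" using P by auto
      show "0\<^sub>v n \<in> ?I" using P by (intro image_eqI[of _ _ "0\<^sub>v m"]) auto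
      show "v + w \<in> ?I" if vw: "v \<in> ?I" "w \<in> ?I" for v w
      proof -
        obtain v' w' where "v' \<in> carrier_vec m" "w' \<in> carrier_vec m" "v = P *\<^sub>v v'" "w = P *\<^sub>v w'"
          using vw by blast
        thus ?thesis
          using P by (intro image_eqI[of _ _ "v' + w'"]) (auto simp: mult_add_distrib_mat_vec)
      qed
      show "c \<cdot>\<^sub>v v \<in> ?I" if v: "v \<in> ?I" for c v
      proof -
        obtain v' where "v' \<in> carrier_vec m" "v = P *\<^sub>v v'" using v by blast
        thus ?thesis using P by (intro image_eqI[of _ _ "c \<cdot>\<^sub>v v'"]) (auto simp: mult_mat_vec)
      qed
    qed
    show "\<tau> g *\<^sub>v w \<in> ?I" if g: "g \<in> carrier G" and w: "w \<in> ?I" for g w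
    proof -
      obtain v where v: "v \<in> carrier_vec m" "w = P *\<^sub>v v" using w by blast
      show ?thesis
        using v commv[OF g v(1)] S(1)[OF g] by (intro image_eqI[of _ _ "\<sigma> g *\<^sub>v v"]) auto
    qed
  qed
  moreover have "?I \<noteq> {0\<^sub>v n}"
  proof
    assume all: "?I = {0\<^sub>v n}"
    have "P *\<^sub>v v = 0\<^sub>v n" if "v \<in> carrier_vec m" for v
      using imageI[OF that, of "\<lambda>v. P *\<^sub>v v"] unfolding all by simp
    hence "P = 0\<^sub>m n m" using P by (intro mat_eqI_vec[of _ n m]) auto
    thus False using nz by simp
  qed
  ultimately have im: "?I = carrier_vec n" by blast
  \<comment> \<open>Surjectivity gives preimages of the unit vectors, which become the columns of a
    right inverse. For \<open>j \<ge> n\<close> the term \<open>unit_vec n j\<close> is the zero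
    vector, so no bound on \<open>j\<close> is required.\<close>
  have "\<forall>j. \<exists>q. q \<in> carrier_vec m \<and> P *\<^sub>v q = unit_vec n j"
  proof
    fix j
    have "unit_vec n j \<in> ?I" unfolding im by simp
    thus "\<exists>q. q \<in> carrier_vec m \<and> P *\<^sub>v q = unit_vec n j" by auto
  qed
  then obtain q where q: "\<And>j. q j \<in> carrier_vec m" "\<And>j. P *\<^sub>v q j = unit_vec n j" by metis
  define Q where "Q = mat_of_cols m (map q [0..<n])"
  have Q: "Q \<in> carrier_mat m n" unfolding Q_def by (intro carrier_matI) simp_all
  have PQ: "P * Q = 1\<^sub>m n"
  proof (rule eq_matI)
    fix i j assume "i < dim_row (1\<^sub>m n :: complex mat)" "j < dim_col (1\<^sub>m n :: complex mat)"
    hence ij: "i < n" "j < n" by auto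
    have "(P * Q) $$ (i, j) = row P i \<bullet> col Q j" using P Q ij by simp
    also have "col Q j = q j" unfolding Q_def using ij q(1) by (simp add: col_mat_of_cols)
    also have "row P i \<bullet> q j = (P *\<^sub>v q j) $ i" using P ij by simp
    finally show "(P * Q) $$ (i, j) = 1\<^sub>m n $$ (i, j)" using q(2) ij by simp
  qed (use P Q in auto)
  \<comment> \<open>Since P Q = 1, the vector Q P v - v lies in the kernel of P, and injectivity
    makes it zero.\<close>
  have QP: "Q * P = 1\<^sub>m m"
  proof (rule mat_eqI_vec)
    fix v :: "complex vec" assume v: "v \<in> carrier_vec m"
    let ?w = "(Q * P) *\<^sub>v v"
    have w: "?w \<in> carrier_vec m" using mult_mat_vec_carrier[OF mult_carrier_mat[OF Q P] v] .
    have "P *\<^sub>v ?w = P *\<^sub>v v"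
    proof -
      have "P *\<^sub>v ?w = (P * (Q * P)) *\<^sub>v v" using assoc_mult_mat_vec[OF P _ v, of "Q * P"] P Q by simp
      also have "P * (Q * P) = P" using assoc_mult_mat[OF P Q P] PQ P by simp
      finally show ?thesis .
    qed
    hence "P *\<^sub>v (?w - v) = 0\<^sub>v n"
      using mult_minus_distrib_mat_vec[OF P w v] P v by simp
    hence "?w - v = 0\<^sub>v m" using ker w v by simp
    have "?w = v"
    proof (rule eq_vecI)
      fix i assume i: "i < dim_vec v"
      have "(?w - v) $ i = 0" unfolding \<open>?w - v = 0\<^sub>v m\<close> using i v by simp
      thus "?w $ i = v $ i" using i by (simp del: index_mult_mat_vec)
    qed (use w v in \<open>simp only: carrier_vecD\<close>)
    thus "Q * P *\<^sub>v v = 1\<^sub>m m *\<^sub>v v" using v by simp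
  qed (use P Q in auto)
  \<comment> \<open>The traces of P Q and Q P are n and m as complex numbers; characteristic zero
    makes n and m equal.\<close>
  have "mat_trace (1\<^sub>m n :: complex mat) = mat_trace (1\<^sub>m m)"
    using mat_trace_mult_comm[OF P Q] PQ QP by simp
  hence "(of_nat n :: complex) = of_nat m" by (simp add: mat_trace_def)
  hence "n = m" by simp
  thus ?thesis using P Q PQ QP invertible_matI[of P m Q] unfolding m_def n_def by auto
qed

text \<open>A complex matrix of positive size has an eigenvalue c. The matrix P - c 1 still commutes
  with \<sigma> but kills an eigenvector, so it is not invertible; an intertwiner that is not
  invertible is zero.\<close>

lemma schur_scalar:
  assumes \<sigma>: "\<sigma> \<in> irreps G"
    and P: "P \<in> carrier_mat (rep_degree G \<sigma>) (rep_degree G \<sigma>)"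
    and comm: "\<And>g. g \<in> carrier G \<Longrightarrow> P * \<sigma> g = \<sigma> g * P"
  shows "\<exists>c. P = c \<cdot>\<^sub>m 1\<^sub>m (rep_degree G \<sigma>)"
proof -
  let ?d = "rep_degree G \<sigma>"
  note S = matrix_repD[OF irrepsD(1)[OF \<sigma>]]
  obtain c where "eigenvalue P c"
    using spectrum_non_empty[OF P irrepsD(2)[OF \<sigma>]] unfolding spectrum_def by blast
  then obtain v where v: "v \<in> carrier_vec ?d" "v \<noteq> 0\<^sub>v ?d" "P *\<^sub>v v = c \<cdot>\<^sub>v v"
    using P unfolding eigenvalue_def eigenvector_def by auto
  let ?R = "P - c \<cdot>\<^sub>m 1\<^sub>m ?d"
  have R: "?R \<in> carrier_mat ?d ?d" using P by auto
  have "?R * \<sigma> g = \<sigma> g * ?R" if g: "g \<in> carrier G" for g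
    using P S(1)[OF g] comm[OF g]
    by (simp add: minus_mult_distrib_mat[of _ ?d ?d] mult_minus_distrib_mat[of _ ?d ?d]
        mult_smult_distrib[of _ ?d ?d _ ?d] mult_smult_assoc_mat[of _ ?d ?d _ ?d])
  moreover have "\<not> invertible_mat ?R"
  proof
    assume "invertible_mat ?R"
    from invertible_matE[OF this R]
    obtain Q where Q: "Q \<in> carrier_mat ?d ?d" "Q * ?R = 1\<^sub>m ?d" by metis
    have "(c \<cdot>\<^sub>m 1\<^sub>m ?d) *\<^sub>v v = c \<cdot>\<^sub>v v"
      using v(1) by (intro eq_vecI) auto
    hence "?R *\<^sub>v v = 0\<^sub>v ?d"
      using P v by (simp add: minus_mult_distrib_mat_vec[of _ ?d ?d])
    hence "v = 0\<^sub>v ?d"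
      using assoc_mult_mat_vec[OF Q(1) R v(1)] mult_mat_zero_vec[OF Q(1)] Q(2) v(1) by simp
    thus False using v by simp
  qed
  ultimately have "?R = 0\<^sub>m ?d ?d" using schur_invertible[OF \<sigma> \<sigma> R] by blast
  have "P = c \<cdot>\<^sub>m 1\<^sub>m ?d"
  proof (rule eq_matI)
    fix i j assume "i < dim_row (c \<cdot>\<^sub>m 1\<^sub>m ?d)" "j < dim_col (c \<cdot>\<^sub>m 1\<^sub>m ?d)"
    hence ij: "i < ?d" "j < ?d" by auto
    have "?R $$ (i, j) = 0" using \<open>?R = 0\<^sub>m ?d ?d\<close> ij by simp
    thus "P $$ (i, j) = (c \<cdot>\<^sub>m 1\<^sub>m ?d) $$ (i, j)" using P ij by simp
  qed (use P in auto)
  thus ?thesis by blast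
qed

section \<open>Orthogonality of matrix entries and of characters\<close>

context group
begin

lemma sum_left_translate:
  fixes f :: "'a \<Rightarrow> 'c :: comm_monoid_add"
  assumes "h \<in> carrier G"
  shows "(\<Sum>g\<in>carrier G. f (h \<otimes> g)) = (\<Sum>g\<in>carrier G. f g)"
proof -
  have "bij_betw (\<lambda>g. h \<otimes> g) (carrier G) (carrier G)"
    using assms by (intro bij_betw_byWitness[of _ "\<lambda>g. inv h \<otimes> g"]) (auto simp flip: m_assoc)
  thus ?thesis by (rule sum.reindex_bij_betw)
qed

text \<open>The sum over the group of \<tau>(g) U \<sigma>(g)^-1, where U is the matrix unit with
  its 1 in position (j, k). The inner indices j and k stay parameters and the outer ones become the
  matrix indices, so Schur's lemma applies to all entries at once.\<close>

definition entry_pairing :: "('a \<Rightarrow> complex mat) \<Rightarrow> ('a \<Rightarrow> complex mat) \<Rightarrow> nat \<Rightarrow> nat \<Rightarrow> complex mat"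
  where "entry_pairing \<tau> \<sigma> j k = mat (rep_degree G \<tau>) (rep_degree G \<sigma>)
    (\<lambda>(i, l). \<Sum>g\<in>carrier G. \<tau> g $$ (i, j) * \<sigma> (inv g) $$ (k, l))"

lemma entry_pairing_carrier:
  "entry_pairing \<tau> \<sigma> j k \<in> carrier_mat (rep_degree G \<tau>) (rep_degree G \<sigma>)"
  by (simp add: entry_pairing_def)

lemma entry_pairing_intertwines:
  assumes \<tau>: "\<tau> \<in> irreps G" and \<sigma>: "\<sigma> \<in> irreps G"
    and j: "j < rep_degree G \<tau>" and k: "k < rep_degree G \<sigma>" and h: "h \<in> carrier G"
  shows "entry_pairing \<tau> \<sigma> j k * \<sigma> h = \<tau> h * entry_pairing \<tau> \<sigma> j k"
proof -
  let ?T = "entry_pairing \<tau> \<sigma> j k" and ?n = "rep_degree G \<tau>" and ?m = "rep_degree G \<sigma>"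
  note t = matrix_repD[OF irrepsD(1)[OF \<tau>]]
  note s = matrix_repD[OF irrepsD(1)[OF \<sigma>]]
  note T = entry_pairing_carrier[of \<tau> \<sigma> j k]
  show ?thesis
  proof (rule eq_matI)
    fix i l assume "i < dim_row (\<tau> h * ?T)" "l < dim_col (\<tau> h * ?T)"
    hence il: "i < ?n" "l < ?m" using t(1)[OF h] T by auto
    let ?f = "\<lambda>g. \<tau> g $$ (i, j) * \<sigma> (inv g \<otimes> h) $$ (k, l)"
    have "(?T * \<sigma> h) $$ (i, l) = (\<Sum>b<?m. ?T $$ (i, b) * \<sigma> h $$ (b, l))"
      by (rule index_mult_mat_sum[OF T s(1)[OF h] il])
    also have "\<dots> = (\<Sum>b<?m. \<Sum>g\<in>carrier G. \<tau> g $$ (i, j) * (\<sigma> (inv g) $$ (k, b) * \<sigma> h $$ (b, l)))"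
      using il by (simp add: entry_pairing_def sum_distrib_right mult.assoc)
    also have "\<dots> = (\<Sum>g\<in>carrier G. \<tau> g $$ (i, j) * (\<Sum>b<?m. \<sigma> (inv g) $$ (k, b) * \<sigma> h $$ (b, l)))"
      by (subst sum.swap) (simp add: sum_distrib_left)
    also have "\<dots> = (\<Sum>g\<in>carrier G. ?f g)"
    proof (rule sum.cong[OF refl])
      fix g assume g: "g \<in> carrier G"
      have "\<sigma> (inv g \<otimes> h) $$ (k, l) = (\<Sum>b<?m. \<sigma> (inv g) $$ (k, b) * \<sigma> h $$ (b, l))"
        unfolding s(2)[OF inv_closed[OF g] h]
        by (rule index_mult_mat_sum[OF s(1)[OF inv_closed[OF g]] s(1)[OF h] k il(2)])
      thus "\<tau> g $$ (i, j) * (\<Sum>b<?m. \<sigma> (inv g) $$ (k, b) * \<sigma> h $$ (b, l)) = ?f g" by simp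
    qed
    \<comment> \<open>The substitution of h g for g turns \<tau>(g) into \<tau>(h) \<tau>(g) and
      g^-1 h into g^-1, which moves h from the right factor to the left one.\<close>
    also have "\<dots> = (\<Sum>g\<in>carrier G. ?f (h \<otimes> g))" by (rule sum_left_translate[OF h, symmetric])
    also have "\<dots> = (\<Sum>g\<in>carrier G. \<Sum>a<?n. \<tau> h $$ (i, a) * (\<tau> g $$ (a, j) * \<sigma> (inv g) $$ (k, l)))"
    proof (rule sum.cong[OF refl])
      fix g assume g: "g \<in> carrier G"
      have "inv (h \<otimes> g) \<otimes> h = inv g" using g h by (simp add: inv_mult_group m_assoc)
      moreover have "\<tau> (h \<otimes> g) $$ (i, j) = (\<Sum>a<?n. \<tau> h $$ (i, a) * \<tau> g $$ (a, j))"
        unfolding t(2)[OF h g] by (rule index_mult_mat_sum[OF t(1)[OF h] t(1)[OF g] il(1) j])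
      ultimately show "?f (h \<otimes> g) = (\<Sum>a<?n. \<tau> h $$ (i, a) * (\<tau> g $$ (a, j) * \<sigma> (inv g) $$ (k, l)))"
        by (simp add: sum_distrib_right mult.assoc)
    qed
    also have "\<dots> = (\<Sum>a<?n. \<tau> h $$ (i, a) * ?T $$ (a, l))"
      using il by (subst sum.swap) (simp add: entry_pairing_def sum_distrib_left)
    also have "\<dots> = (\<tau> h * ?T) $$ (i, l)" by (rule index_mult_mat_sum[OF t(1)[OF h] T il, symmetric])
    finally show "(?T * \<sigma> h) $$ (i, l) = (\<tau> h * ?T) $$ (i, l)" .
  qed (use t(1)[OF h] s(1)[OF h] T in auto)
qed

text \<open>By Schur's lemma a nonzero pairing matrix would be an invertible intertwiner from
  \<sigma> to \<tau>, hence a witness of their equivalence.\<close>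

lemma entries_orthogonal:
  assumes \<tau>: "\<tau> \<in> irreps G" and \<sigma>: "\<sigma> \<in> irreps G" and neq: "(\<sigma>, \<tau>) \<notin> rep_equiv G"
    and "i < rep_degree G \<tau>" "j < rep_degree G \<tau>" "k < rep_degree G \<sigma>" "l < rep_degree G \<sigma>"
  shows "(\<Sum>g\<in>carrier G. \<tau> g $$ (i, j) * \<sigma> (inv g) $$ (k, l)) = 0"
proof -
  let ?T = "entry_pairing \<tau> \<sigma> j k"
  note comm = entry_pairing_intertwines[OF \<tau> \<sigma> assms(5,6)]
  have "?T = 0\<^sub>m (rep_degree G \<tau>) (rep_degree G \<sigma>)"
  proof (rule ccontr)
    assume "?T \<noteq> 0\<^sub>m (rep_degree G \<tau>) (rep_degree G \<sigma>)"
    from schur_invertible[OF \<sigma> \<tau> entry_pairing_carrier comm this]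
    have *: "rep_degree G \<sigma> = rep_degree G \<tau>" "invertible_mat ?T" by auto
    have "?T \<in> carrier_mat (rep_degree G \<sigma>) (rep_degree G \<sigma>)"
      using entry_pairing_carrier[of \<tau> \<sigma> j k] * by simp
    hence "(\<sigma>, \<tau>) \<in> rep_equiv G" using \<sigma> \<tau> * comm by (intro rep_equivI)
    with neq show False by simp
  qed
  hence "?T $$ (i, l) = 0" using assms by simp
  thus ?thesis using assms by (simp add: entry_pairing_def)
qed

text \<open>The pairing matrix is a scalar c by Schur's lemma, and its trace determines c: because
  \<sigma>(g^-1) \<sigma>(g) = 1, each g contributes 1 if k = j and 0 otherwise, so d c is the group
  order or 0.\<close>

lemma entries_orthogonal_same:
  assumes \<sigma>: "\<sigma> \<in> irreps G" and "i < rep_degree G \<sigma>" and j: "j < rep_degree G \<sigma>"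
    and k: "k < rep_degree G \<sigma>" and "l < rep_degree G \<sigma>"
  shows "(\<Sum>g\<in>carrier G. \<sigma> g $$ (i, j) * \<sigma> (inv g) $$ (k, l))
    = (if i = l \<and> j = k then of_nat (Coset.order G) / of_nat (rep_degree G \<sigma>) else 0)"
proof -
  let ?T = "entry_pairing \<sigma> \<sigma> j k" and ?d = "rep_degree G \<sigma>"
  note s = matrix_repD[OF irrepsD(1)[OF \<sigma>]]
  obtain c where c: "?T = c \<cdot>\<^sub>m 1\<^sub>m ?d"
    using schur_scalar[OF \<sigma> entry_pairing_carrier entry_pairing_intertwines[OF \<sigma> \<sigma> j k]] by blast
  have T: "(\<Sum>g\<in>carrier G. \<sigma> g $$ (a, j) * \<sigma> (inv g) $$ (k, b)) = (if a = b then c else 0)"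
    if "a < ?d" "b < ?d" for a b
  proof -
    have "?T $$ (a, b) = (c \<cdot>\<^sub>m 1\<^sub>m ?d) $$ (a, b)" using c by simp
    thus ?thesis using that by (simp add: entry_pairing_def split: if_splits)
  qed
  have "of_nat ?d * c = (\<Sum>a<?d. \<Sum>g\<in>carrier G. \<sigma> g $$ (a, j) * \<sigma> (inv g) $$ (k, a))"
    using T by simp
  also have "\<dots> = (\<Sum>g\<in>carrier G. \<Sum>a<?d. \<sigma> (inv g) $$ (k, a) * \<sigma> g $$ (a, j))"
    by (subst sum.swap) (simp add: mult.commute)
  also have "\<dots> = (\<Sum>g\<in>carrier G. if k = j then 1 else 0)"
  proof (rule sum.cong[OF refl])
    fix g assume g: "g \<in> carrier G"
    have "(\<Sum>a<?d. \<sigma> (inv g) $$ (k, a) * \<sigma> g $$ (a, j)) = (\<sigma> (inv g) * \<sigma> g) $$ (k, j)"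
      by (rule index_mult_mat_sum[OF s(1)[OF inv_closed[OF g]] s(1)[OF g] k j, symmetric])
    also have "\<sigma> (inv g) * \<sigma> g = 1\<^sub>m ?d"
      using s(2)[OF inv_closed[OF g] g] s(3) g by simp
    finally show "(\<Sum>a<?d. \<sigma> (inv g) $$ (k, a) * \<sigma> g $$ (a, j)) = (if k = j then 1 else 0)"
      using k j by simp
  qed
  finally have "of_nat ?d * c = (if k = j then of_nat (Coset.order G) else 0)" by (simp add: Coset.order_def)
  hence "c = (if k = j then of_nat (Coset.order G) / of_nat ?d else 0)"
    using irrepsD(2)[OF \<sigma>] by (auto simp: field_simps split: if_splits)
  thus ?thesis using T[OF assms(2,5)] by auto
qed

lemma sum_characters_expand:
  assumes \<tau>: "\<tau> \<in> irreps G" and \<sigma>: "\<sigma> \<in> irreps G"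
  shows "(\<Sum>g\<in>carrier G. character \<tau> g * character \<sigma> (inv g))
    = (\<Sum>i<rep_degree G \<tau>. \<Sum>k<rep_degree G \<sigma>. \<Sum>g\<in>carrier G. \<tau> g $$ (i, i) * \<sigma> (inv g) $$ (k, k))"
proof -
  note t = matrix_repD(1)[OF irrepsD(1)[OF \<tau>]] and s = matrix_repD(1)[OF irrepsD(1)[OF \<sigma>]]
  have "(\<Sum>g\<in>carrier G. character \<tau> g * character \<sigma> (inv g))
    = (\<Sum>g\<in>carrier G. \<Sum>i<rep_degree G \<tau>. \<Sum>k<rep_degree G \<sigma>. \<tau> g $$ (i, i) * \<sigma> (inv g) $$ (k, k))"
    using t s inv_closed
    by (intro sum.cong[OF refl]) (simp add: character_def sum_product carrier_matD(1)[OF t]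
        carrier_matD(1)[OF s])
  also have "\<dots> = (\<Sum>i<rep_degree G \<tau>. \<Sum>g\<in>carrier G. \<Sum>k<rep_degree G \<sigma>. \<tau> g $$ (i, i) * \<sigma> (inv g) $$ (k, k))"
    by (rule sum.swap)
  also have "\<dots> = (\<Sum>i<rep_degree G \<tau>. \<Sum>k<rep_degree G \<sigma>. \<Sum>g\<in>carrier G. \<tau> g $$ (i, i) * \<sigma> (inv g) $$ (k, k))"
    by (intro sum.cong[OF refl] sum.swap)
  finally show ?thesis .
qed

end

lemma character_rep_equiv:
  assumes "(\<sigma>, \<tau>) \<in> rep_equiv G" and g: "g \<in> carrier G"
  shows "character \<sigma> g = character \<tau> g"
proof -
  obtain P where st: "\<sigma> \<in> irreps G" "\<tau> \<in> irreps G" "rep_degree G \<tau> = rep_degree G \<sigma>"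
    and P: "P \<in> carrier_mat (rep_degree G \<sigma>) (rep_degree G \<sigma>)" "invertible_mat P"
      "\<And>g. g \<in> carrier G \<Longrightarrow> P * \<sigma> g = \<tau> g * P"
    by (rule rep_equivE[OF assms(1)]) blast
  let ?d = "rep_degree G \<sigma>"
  obtain Q where Q: "Q \<in> carrier_mat ?d ?d" "P * Q = 1\<^sub>m ?d" "Q * P = 1\<^sub>m ?d"
    by (rule invertible_matE[OF P(2,1)])
  have c: "\<sigma> g \<in> carrier_mat ?d ?d" "\<tau> g \<in> carrier_mat ?d ?d"
    using irreps_carrier_mat[OF st(1) g] irreps_carrier_mat[OF st(2) g] st(3) by simp_all
  have "\<sigma> g = Q * \<tau> g * P"
    using P Q c by (simp add: assoc_mult_mat[of Q ?d ?d _ ?d _ ?d] flip: P(3)[OF g])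
      (simp flip: assoc_mult_mat[of Q ?d ?d _ ?d _ ?d])
  thus ?thesis using mat_trace_similar[OF P(1) Q(1) c(2) Q(2)] by (simp add: character_eq_mat_trace)
qed

context group
begin

lemma characters_orthonormal:
  assumes \<tau>: "\<tau> \<in> irreps G" and \<sigma>: "\<sigma> \<in> irreps G"
  shows "(\<Sum>g\<in>carrier G. character \<tau> g * character \<sigma> (inv g))
    = (if (\<tau>, \<sigma>) \<in> rep_equiv G then of_nat (Coset.order G) else 0)"
proof (cases "(\<tau>, \<sigma>) \<in> rep_equiv G")
  case False
  hence "(\<sigma>, \<tau>) \<notin> rep_equiv G"
    using equiv_rep_equiv[of G] by (meson equivE symD)
  thus ?thesis
    using False by (simp add: sum_characters_expand[OF \<tau> \<sigma>] entries_orthogonal[OF \<tau> \<sigma>])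
next
  case True
  let ?d = "rep_degree G \<sigma>"
  have "(\<Sum>g\<in>carrier G. character \<tau> g * character \<sigma> (inv g))
    = (\<Sum>g\<in>carrier G. character \<sigma> g * character \<sigma> (inv g))"
    using character_rep_equiv[OF True] by simp
  \<comment> \<open>Only the d pairings with equal diagonal indices survive, and each contributes
    the group order divided by d.\<close>
  also have "\<dots> = (\<Sum>i<?d. \<Sum>k<?d. if i = k then of_nat (Coset.order G) / of_nat ?d else 0)"
    unfolding sum_characters_expand[OF \<sigma> \<sigma>]
    by (intro sum.cong[OF refl]) (simp add: entries_orthogonal_same[OF \<sigma>])
  also have "\<dots> = of_nat (Coset.order G)" using irrepsD(2)[OF \<sigma>] by simp
  finally show ?thesis using True by simp
qed

subsection \<open>The regular character\<close>

text \<open>Left translation by g, as a permutation matrix with respect to an enumeration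
  \<open>e\<close> of the group. A diagonal entry is nonzero only if g fixes \<open>e i\<close>
  under translation, that is, only for the identity.\<close>

lemma regular_representation:
  assumes fin: "finite (carrier G)"
  obtains R where "matrix_rep G (Coset.order G) R"
    "\<And>g. g \<in> carrier G \<Longrightarrow> character R g = (if g = \<one> then of_nat (Coset.order G) else 0)"
proof -
  let ?n = "Coset.order G"
  obtain e where e: "bij_betw e {..<?n} (carrier G)"
    using ex_bij_betw_nat_finite[OF fin] by (auto simp: Coset.order_def lessThan_atLeast0)
  have inj: "e i = e j \<longleftrightarrow> i = j" if "i < ?n" "j < ?n" for i j
    using e that by (auto simp: bij_betw_def inj_on_def)
  have mem: "e i \<in> carrier G" if "i < ?n" for i using e that by (auto simp: bij_betw_def)
  define R where "R g = mat ?n ?n (\<lambda>(i, j). if e i = g \<otimes> e j then 1 else 0 :: complex)" for g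
  have R: "R g \<in> carrier_mat ?n ?n" for g by (simp add: R_def)
  have "matrix_rep G ?n R"
    unfolding matrix_rep_def
  proof (intro conjI ballI R)
    show "R \<one> = 1\<^sub>m ?n" by (rule eq_matI) (auto simp: R_def mem inj)
    fix g h assume g: "g \<in> carrier G" and h: "h \<in> carrier G"
    show "R (g \<otimes> h) = R g * R h"
    proof (rule eq_matI)
      fix i j assume "i < dim_row (R g * R h)" "j < dim_col (R g * R h)"
      hence ij: "i < ?n" "j < ?n" by (auto simp: R_def)
      have "h \<otimes> e j \<in> carrier G" using h mem ij by simp
      then obtain m where m: "m < ?n" "e m = h \<otimes> e j"
        using e unfolding bij_betw_def by (metis imageE lessThan_iff)
      have "(R g * R h) $$ (i, j) = (\<Sum>k<?n. R g $$ (i, k) * R h $$ (k, j))"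
        by (rule index_mult_mat_sum[OF R R ij])
      \<comment> \<open>Column \<open>j\<close> of \<open>R h\<close> has its single nonzero entry
        in row \<open>m\<close>, the position of \<open>h \<otimes> e j\<close> in the
        enumeration.\<close>
      also have "\<dots> = (\<Sum>k<?n. if k = m then R g $$ (i, m) else 0)"
        using ij m by (intro sum.cong) (auto simp: R_def inj simp flip: m(2))
      also have "\<dots> = R g $$ (i, m)" using m by simp
      also have "\<dots> = R (g \<otimes> h) $$ (i, j)" using ij m g h mem by (simp add: R_def m_assoc)
      finally show "R (g \<otimes> h) $$ (i, j) = (R g * R h) $$ (i, j)" by simp
    qed (simp_all add: R_def)
  qed
  moreover have "character R g = (if g = \<one> then of_nat ?n else 0)" if g: "g \<in> carrier G" for g
  proof -
    have "R g $$ (i, i) = (if g = \<one> then 1 else 0)" if "i < ?n" for i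
      using that g mem[OF that] by (auto simp: R_def eq_commute[of "e i"])
    thus ?thesis by (simp add: character_def carrier_matD(1)[OF R])
  qed
  ultimately show thesis by (rule that)
qed

section \<open>Multiplicities of the irreducible classes in the regular character\<close>

lemma dual_class:
  assumes rho: "unitary_representatives G \<rho>" and C: "C \<in> dual G"
  shows "\<rho> C \<in> irreps G" and "(\<sigma>, \<rho> C) \<in> rep_equiv G \<longleftrightarrow> \<sigma> \<in> C"
proof -
  have mem: "\<rho> C \<in> C" using assms by (simp add: unitary_representatives_def)
  have C': "C \<in> irreps G // rep_equiv G" using C by (simp add: dual_def)
  show "\<rho> C \<in> irreps G" using mem in_quotient_imp_subset[OF equiv_rep_equiv C'] by blast
  show "(\<sigma>, \<rho> C) \<in> rep_equiv G \<longleftrightarrow> \<sigma> \<in> C"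
  proof
    assume "(\<sigma>, \<rho> C) \<in> rep_equiv G"
    hence "(\<rho> C, \<sigma>) \<in> rep_equiv G" using equiv_rep_equiv[of G] by (meson equivE symD)
    thus "\<sigma> \<in> C" using in_quotient_imp_closed[OF equiv_rep_equiv C' mem] by blast
  next
    assume "\<sigma> \<in> C"
    thus "(\<sigma>, \<rho> C) \<in> rep_equiv G"
      using in_quotient_imp_in_rel[OF equiv_rep_equiv C'] mem by simp
  qed
qed

lemma sum_degree_character:
  assumes fin: "finite (carrier G)" and rho: "unitary_representatives G \<rho>"
    and g: "g \<in> carrier G"
  shows "(\<Sum>C\<in>dual G. of_nat (rep_degree G (\<rho> C)) * character (\<rho> C) g)
      = (if g = \<one> then of_nat (Coset.order G) else 0)"
proof -
  obtain R where R: "matrix_rep G (Coset.order G) R"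
    "\<And>g. g \<in> carrier G \<Longrightarrow> character R g = (if g = \<one> then of_nat (Coset.order G) else 0)"
    using regular_representation[OF fin] by blast
  obtain \<sigma>s where \<sigma>s: "set \<sigma>s \<subseteq> irreps G"
    and reg: "\<And>g. g \<in> carrier G \<Longrightarrow>
      (\<Sum>\<sigma>\<leftarrow>\<sigma>s. character \<sigma> g) = (if g = \<one> then of_nat (Coset.order G) else 0)"
    using character_eq_sum_irreps[OF R(1)] R(2) by metis
  have n0: "of_nat (Coset.order G) \<noteq> (0 :: complex)"
    using order_gt_0_iff_finite fin by simp
  \<comment> \<open>The regular character is paired with that of \<tau> in two ways. Orthogonality
    counts the members of the list equivalent to \<tau>, each weighted by the group order; direct
    evaluation leaves only the identity, where the character of \<tau> is its degree.\<close>
  have mult: "(\<Sum>\<sigma>\<leftarrow>\<sigma>s. if (\<sigma>, \<tau>) \<in> rep_equiv G then 1 else 0) = (of_nat (rep_degree G \<tau>) :: complex)"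
    if \<tau>: "\<tau> \<in> irreps G" for \<tau>
  proof -
    have "of_nat (Coset.order G) * (\<Sum>\<sigma>\<leftarrow>\<sigma>s. if (\<sigma>, \<tau>) \<in> rep_equiv G then 1 else 0)
      = (\<Sum>\<sigma>\<leftarrow>\<sigma>s. \<Sum>g\<in>carrier G. character \<sigma> g * character \<tau> (inv g))"
      unfolding sum_list_const_mult[symmetric]
    proof (intro arg_cong[of _ _ sum_list] map_cong[OF refl])
      fix \<sigma> assume "\<sigma> \<in> set \<sigma>s"
      hence "\<sigma> \<in> irreps G" using \<sigma>s by blast
      from characters_orthonormal[OF this \<tau>]
      show "of_nat (Coset.order G) * (if (\<sigma>, \<tau>) \<in> rep_equiv G then 1 else 0)
        = (\<Sum>g\<in>carrier G. character \<sigma> g * character \<tau> (inv g))" by simp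
    qed
    also have "\<dots> = (\<Sum>g\<in>carrier G. (\<Sum>\<sigma>\<leftarrow>\<sigma>s. character \<sigma> g) * character \<tau> (inv g))"
      by (induction \<sigma>s) (simp_all add: sum.distrib distrib_right)
    also have "\<dots> = (\<Sum>g\<in>carrier G. if g = \<one> then of_nat (Coset.order G) * character \<tau> (inv g) else 0)"
      by (intro sum.cong) (auto simp: reg)
    also have "\<dots> = of_nat (Coset.order G) * character \<tau> \<one>" using fin by simp
    also have "character \<tau> \<one> = of_nat (rep_degree G \<tau>)"
      using matrix_repD(3)[OF irrepsD(1)[OF \<tau>]] by (simp add: character_def)
    finally show ?thesis using n0 by simp
  qed
  have rel_class: "(\<sigma>, \<rho> C) \<in> rep_equiv G \<longleftrightarrow> C = rep_equiv G `` {\<sigma>}"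
    if "C \<in> dual G" "\<sigma> \<in> irreps G" for C \<sigma>
  proof -
    have C: "C \<in> irreps G // rep_equiv G" using that by (simp add: dual_def)
    have s: "\<sigma> \<in> rep_equiv G `` {\<sigma>}" "rep_equiv G `` {\<sigma>} \<in> irreps G // rep_equiv G"
      using equiv_class_self[OF equiv_rep_equiv that(2)] quotientI[OF that(2)] by auto
    show ?thesis
      unfolding dual_class(2)[OF rho that(1)]
      using quotient_disj[OF equiv_rep_equiv C s(2)] s(1) by blast
  qed
  \<comment> \<open>A class without a member in the list would have multiplicity 0, whereas its
    multiplicity is a positive degree.\<close>
  have "dual G \<subseteq> (\<lambda>\<sigma>. rep_equiv G `` {\<sigma>}) ` set \<sigma>s"
  proof
    fix C assume C: "C \<in> dual G"
    note irr = dual_class(1)[OF rho C]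
    have "(\<Sum>\<sigma>\<leftarrow>\<sigma>s. if (\<sigma>, \<rho> C) \<in> rep_equiv G then 1 else 0 :: complex) \<noteq> 0"
      using mult[OF irr] irrepsD(2)[OF irr] by simp
    hence "\<exists>\<sigma>\<in>set \<sigma>s. (\<sigma>, \<rho> C) \<in> rep_equiv G"
      by (rule contrapos_np) (simp cong: map_cong)
    then obtain \<sigma> where "\<sigma> \<in> set \<sigma>s" "(\<sigma>, \<rho> C) \<in> rep_equiv G" by blast
    thus "C \<in> (\<lambda>\<sigma>. rep_equiv G `` {\<sigma>}) ` set \<sigma>s" using rel_class[OF C] \<sigma>s by blast
  qed
  hence fin_dual: "finite (dual G)" by (rule finite_subset) simp
  \<comment> \<open>Each degree is replaced by the count of list members in its class. After
    exchanging the sums, every list member belongs to exactly one class and contributes its own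
    character once, which restores the regular character.\<close>
  have "(\<Sum>C\<in>dual G. of_nat (rep_degree G (\<rho> C)) * character (\<rho> C) g)
    = (\<Sum>C\<in>dual G. \<Sum>\<sigma>\<leftarrow>\<sigma>s. if (\<sigma>, \<rho> C) \<in> rep_equiv G then character (\<rho> C) g else 0)"
  proof (rule sum.cong[OF refl])
    fix C assume C: "C \<in> dual G"
    show "of_nat (rep_degree G (\<rho> C)) * character (\<rho> C) g
      = (\<Sum>\<sigma>\<leftarrow>\<sigma>s. if (\<sigma>, \<rho> C) \<in> rep_equiv G then character (\<rho> C) g else 0)"
      unfolding mult[OF dual_class(1)[OF rho C], symmetric] sum_list_mult_const[symmetric]
      by (intro arg_cong[of _ _ sum_list] map_cong[OF refl]) simp
  qed
  also have "\<dots> = (\<Sum>\<sigma>\<leftarrow>\<sigma>s. \<Sum>C\<in>dual G. if (\<sigma>, \<rho> C) \<in> rep_equiv G then character (\<rho> C) g else 0)"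
    by (induction \<sigma>s) (simp_all add: sum.distrib)
  also have "\<dots> = (\<Sum>\<sigma>\<leftarrow>\<sigma>s. character \<sigma> g)"
  proof (intro arg_cong[of _ _ sum_list] map_cong[OF refl])
    fix \<sigma> assume "\<sigma> \<in> set \<sigma>s"
    hence irr: "\<sigma> \<in> irreps G" using \<sigma>s by blast
    have "(\<Sum>C\<in>dual G. if (\<sigma>, \<rho> C) \<in> rep_equiv G then character (\<rho> C) g else 0)
      = (\<Sum>C\<in>dual G. if C = rep_equiv G `` {\<sigma>} then character \<sigma> g else 0)"
    proof (rule sum.cong[OF refl])
      fix C assume "C \<in> dual G"
      thus "(if (\<sigma>, \<rho> C) \<in> rep_equiv G then character (\<rho> C) g else 0)
        = (if C = rep_equiv G `` {\<sigma>} then character \<sigma> g else 0)"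
        using rel_class[OF _ irr, of C] character_rep_equiv[of \<sigma> "\<rho> C", OF _ g] by auto
    qed
    also have "\<dots> = character \<sigma> g"
      using fin_dual quotientI[OF irr, of "rep_equiv G"] by (simp add: dual_def)
    finally show "(\<Sum>C\<in>dual G. if (\<sigma>, \<rho> C) \<in> rep_equiv G then character (\<rho> C) g else 0)
      = character \<sigma> g" .
  qed
  also have "\<dots> = (if g = \<one> then of_nat (Coset.order G) else 0)" by (rule reg[OF g])
  finally show ?thesis .
qed

end

subsection \<open>Invariant functions in a block\<close>

definition trace_fun ::
    "('g, 'm) monoid_scheme \<Rightarrow> ('g \<Rightarrow> complex mat) \<Rightarrow> complex mat \<Rightarrow> 'g \<Rightarrow> complex"
  where "trace_fun G \<sigma> C = (\<lambda>g. if g \<in> carrier G then mat_trace (C * \<sigma> g) else 0)"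

lemma sum_fun_apply: "(\<Sum>x\<in>A. f x) g = (\<Sum>x\<in>A. f x g)"
  by (induction A rule: infinite_finite_induct) (simp_all add: zero_fun_def)

text \<open>The trace functions form a subspace, and the matrix units among the coefficient matrices
  give the spanning entries of the block. A coefficient matrix thus names an element of the block
  without any choice of linear combination.\<close>

lemma block_eq_trace_fun:
  assumes rep: "matrix_rep G d \<sigma>"
  shows "block G \<sigma> = trace_fun G \<sigma> ` carrier_mat d d"
proof
  note s = matrix_repD(1)[OF rep] and deg = rep_degree_eq[OF rep]
  have tf: "trace_fun G \<sigma> C g = (\<Sum>a<d. \<Sum>b<d. C $$ (a, b) * \<sigma> g $$ (b, a))"
    if "C \<in> carrier_mat d d" "g \<in> carrier G" for C g
    using mat_trace_mult[OF that(1) s[OF that(2)]] that(2) by (simp add: trace_fun_def)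
  show "block G \<sigma> \<subseteq> trace_fun G \<sigma> ` carrier_mat d d"
    unfolding block_def
  proof (rule cfun.span_minimal)
    show "{matrix_entry G \<sigma> i j |i j. i < rep_degree G \<sigma> \<and> j < rep_degree G \<sigma>}
      \<subseteq> trace_fun G \<sigma> ` carrier_mat d d"
    proof safe
      fix i j assume ij: "i < rep_degree G \<sigma>" "j < rep_degree G \<sigma>"
      \<comment> \<open>The indices are transposed: the trace pairs the entry (a, b) of the
        coefficient with the entry (b, a) of \<sigma>(g), so the entry (i, j) of \<sigma> comes from
        the matrix unit at (j, i).\<close>
      let ?C = "mat d d (\<lambda>(a, b). if a = j then if b = i then 1 else 0 else 0) :: complex mat"
      have "matrix_entry G \<sigma> i j g = trace_fun G \<sigma> ?C g" for g
      proof (cases "g \<in> carrier G")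
        case True
        have "trace_fun G \<sigma> ?C g
          = (\<Sum>a<d. \<Sum>b<d. if a = j then if b = i then \<sigma> g $$ (b, a) else 0 else 0)"
          by (subst tf[OF _ True]) (auto intro!: sum.cong)
        also have "\<dots> = (\<Sum>a<d. if a = j then \<sigma> g $$ (i, a) else 0)"
          using ij deg by (intro sum.cong) auto
        also have "\<dots> = \<sigma> g $$ (i, j)" using ij deg by simp
        finally show ?thesis using True by (simp add: matrix_entry_def)
      qed (simp add: matrix_entry_def trace_fun_def)
      thus "matrix_entry G \<sigma> i j \<in> trace_fun G \<sigma> ` carrier_mat d d"
        by (intro image_eqI[of _ _ ?C]) auto
    qed
    show "cfun.subspace (trace_fun G \<sigma> ` carrier_mat d d)"
    proof (rule cfun.subspaceI)
      have "trace_fun G \<sigma> (0\<^sub>m d d) = 0"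
      proof
        fix g show "trace_fun G \<sigma> (0\<^sub>m d d) g = 0 g"
          using tf[OF zero_carrier_mat, of g]
          by (cases "g \<in> carrier G") (simp_all add: trace_fun_def)
      qed
      thus "0 \<in> trace_fun G \<sigma> ` carrier_mat d d"
        by (metis image_eqI zero_carrier_mat)
      fix F F' assume "F \<in> trace_fun G \<sigma> ` carrier_mat d d" "F' \<in> trace_fun G \<sigma> ` carrier_mat d d"
      then obtain C D where C: "C \<in> carrier_mat d d" "F = trace_fun G \<sigma> C"
        and D: "D \<in> carrier_mat d d" "F' = trace_fun G \<sigma> D" by blast
      have "F + F' = trace_fun G \<sigma> (C + D)"
      proof
        fix g show "(F + F') g = trace_fun G \<sigma> (C + D) g"
        proof (cases "g \<in> carrier G")
          case True
          have CD: "C + D \<in> carrier_mat d d" using C D by simp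
          show ?thesis
            using C D by (simp add: tf[OF C(1) True] tf[OF D(1) True] tf[OF CD True]
                distrib_right sum.distrib)
        qed (simp add: C D trace_fun_def)
      qed
      thus "F + F' \<in> trace_fun G \<sigma> ` carrier_mat d d" using C D by auto
    next
      fix c F assume "F \<in> trace_fun G \<sigma> ` carrier_mat d d"
      then obtain C where C: "C \<in> carrier_mat d d" "F = trace_fun G \<sigma> C" by blast
      have "fun_scale c F = trace_fun G \<sigma> (c \<cdot>\<^sub>m C)"
      proof
        fix g show "fun_scale c F g = trace_fun G \<sigma> (c \<cdot>\<^sub>m C) g"
        proof (cases "g \<in> carrier G")
          case True
          have cC: "c \<cdot>\<^sub>m C \<in> carrier_mat d d" using C by simp
          show ?thesis
            using C by (simp add: fun_scale_def tf[OF C(1) True] tf[OF cC True]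
                sum_distrib_left mult.assoc)
        qed (simp add: C fun_scale_def trace_fun_def)
      qed
      thus "fun_scale c F \<in> trace_fun G \<sigma> ` carrier_mat d d" using C by auto
    qed
  qed
  show "trace_fun G \<sigma> ` carrier_mat d d \<subseteq> block G \<sigma>"
  proof safe
    fix C :: "complex mat" assume C: "C \<in> carrier_mat d d"
    have "trace_fun G \<sigma> C
      = (\<Sum>a<d. \<Sum>b<d. fun_scale (C $$ (a, b)) (matrix_entry G \<sigma> b a))"
    proof
      fix g show "trace_fun G \<sigma> C g
        = (\<Sum>a<d. \<Sum>b<d. fun_scale (C $$ (a, b)) (matrix_entry G \<sigma> b a)) g"
        using tf[OF C, of g]
        by (cases "g \<in> carrier G")
          (simp_all add: sum_fun_apply fun_scale_def matrix_entry_def trace_fun_def)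
    qed
    also have "\<dots> \<in> block G \<sigma>"
      unfolding block_def
      by (intro cfun.span_sum cfun.span_scale cfun.span_base) (auto simp: deg)
    finally show "trace_fun G \<sigma> C \<in> block G \<sigma>" .
  qed
qed

section \<open>Averaging over a subgroup, on matrices and on functions\<close>

context group
begin

lemma sum_subgroup_right_translate:
  fixes f :: "'a \<Rightarrow> 'c :: comm_monoid_add"
  assumes H: "subgroup H G" and h: "h \<in> H"
  shows "(\<Sum>x\<in>H. f (x \<otimes> h)) = (\<Sum>x\<in>H. f x)"
proof -
  have "bij_betw (\<lambda>x. x \<otimes> h) H H"
    using h subgroup.m_closed[OF H] subgroup.m_inv_closed[OF H] subgroup.mem_carrier[OF H]
    by (intro bij_betw_byWitness[of _ "\<lambda>x. x \<otimes> inv h"]) (auto simp: m_assoc)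
  thus ?thesis by (rule sum.reindex_bij_betw)
qed

definition avg_mat :: "'a set \<Rightarrow> nat \<Rightarrow> ('a \<Rightarrow> complex mat) \<Rightarrow> complex mat"
  where "avg_mat H d \<sigma> = mat d d (\<lambda>(i, j). 1 / of_nat (card H) * (\<Sum>h\<in>H. \<sigma> h $$ (i, j)))"

lemma avg_mat_carrier: "avg_mat H d \<sigma> \<in> carrier_mat d d"
  by (simp add: avg_mat_def)

lemma index_avg_mat_mult:
  assumes rep: "matrix_rep G d \<sigma>" and H: "subgroup H G" and g: "g \<in> carrier G"
    and ij: "i < d" "j < d"
  shows "(avg_mat H d \<sigma> * \<sigma> g) $$ (i, j) = 1 / of_nat (card H) * (\<Sum>h\<in>H. \<sigma> (h \<otimes> g) $$ (i, j))"
proof -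
  note s = matrix_repD[OF rep]
  have "(\<Sum>h\<in>H. \<sigma> (h \<otimes> g) $$ (i, j)) = (\<Sum>h\<in>H. \<Sum>k<d. \<sigma> h $$ (i, k) * \<sigma> g $$ (k, j))"
  proof (rule sum.cong[OF refl])
    fix h assume "h \<in> H"
    hence h: "h \<in> carrier G" by (rule subgroup.mem_carrier[OF H])
    show "\<sigma> (h \<otimes> g) $$ (i, j) = (\<Sum>k<d. \<sigma> h $$ (i, k) * \<sigma> g $$ (k, j))"
      unfolding s(2)[OF h g] by (rule index_mult_mat_sum[OF s(1)[OF h] s(1)[OF g] ij])
  qed
  also have "\<dots> = (\<Sum>k<d. (\<Sum>h\<in>H. \<sigma> h $$ (i, k)) * \<sigma> g $$ (k, j))"
    by (subst sum.swap) (simp add: sum_distrib_right)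
  finally show ?thesis
    unfolding index_mult_mat_sum[OF avg_mat_carrier s(1)[OF g] ij]
    using ij by (simp add: avg_mat_def sum_divide_distrib[symmetric])
qed

lemma avg_mat_mult_subgroup:
  assumes rep: "matrix_rep G d \<sigma>" and H: "subgroup H G" and h: "h \<in> H"
  shows "avg_mat H d \<sigma> * \<sigma> h = avg_mat H d \<sigma>"
proof (rule eq_matI)
  have hG: "h \<in> carrier G" using h by (rule subgroup.mem_carrier[OF H])
  fix i j assume "i < dim_row (avg_mat H d \<sigma>)" "j < dim_col (avg_mat H d \<sigma>)"
  hence ij: "i < d" "j < d" by (auto simp: avg_mat_def)
  show "(avg_mat H d \<sigma> * \<sigma> h) $$ (i, j) = avg_mat H d \<sigma> $$ (i, j)"
    unfolding index_avg_mat_mult[OF rep H hG ij] sum_subgroup_right_translate[OF H h, of "\<lambda>x. \<sigma> x $$ (i, j)"]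
    using ij by (simp add: avg_mat_def)
next
  show "dim_row (avg_mat H d \<sigma> * \<sigma> h) = dim_row (avg_mat H d \<sigma>)" by simp
  show "dim_col (avg_mat H d \<sigma> * \<sigma> h) = dim_col (avg_mat H d \<sigma>)"
    using matrix_repD(1)[OF rep subgroup.mem_carrier[OF H h]] by (simp add: avg_mat_def)
qed

text \<open>With the second factor expanded as an average over H, every summand is
  \<open>avg_mat H d \<sigma> * \<sigma> h\<close>, which is again
  \<open>avg_mat H d \<sigma>\<close>; what remains is the average of a constant.\<close>

lemma avg_mat_idempotent:
  assumes rep: "matrix_rep G d \<sigma>" and H: "subgroup H G" and fin: "finite H"
  shows "avg_mat H d \<sigma> * avg_mat H d \<sigma> = avg_mat H d \<sigma>"
proof (rule eq_matI)
  let ?E = "avg_mat H d \<sigma>"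
  have c: "card H > 0" using fin subgroup.one_closed[OF H] by (auto simp: card_gt_0_iff)
  fix i j assume "i < dim_row ?E" "j < dim_col ?E"
  hence ij: "i < d" "j < d" by (auto simp: avg_mat_def)
  have "(?E * ?E) $$ (i, j) = (\<Sum>k<d. ?E $$ (i, k) * ?E $$ (k, j))"
    by (rule index_mult_mat_sum[OF avg_mat_carrier avg_mat_carrier ij])
  also have "\<dots> = (\<Sum>k<d. \<Sum>h\<in>H. 1 / of_nat (card H) * (?E $$ (i, k) * \<sigma> h $$ (k, j)))"
  proof (rule sum.cong[OF refl])
    fix k assume "k \<in> {..<d}"
    hence "?E $$ (k, j) = 1 / of_nat (card H) * (\<Sum>h\<in>H. \<sigma> h $$ (k, j))"
      using ij by (simp add: avg_mat_def)
    thus "?E $$ (i, k) * ?E $$ (k, j)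
      = (\<Sum>h\<in>H. 1 / of_nat (card H) * (?E $$ (i, k) * \<sigma> h $$ (k, j)))"
      by (simp add: sum_distrib_left mult_ac)
  qed
  also have "\<dots> = (\<Sum>h\<in>H. 1 / of_nat (card H) * (\<Sum>k<d. ?E $$ (i, k) * \<sigma> h $$ (k, j)))"
    by (subst sum.swap) (simp add: sum_distrib_left)
  also have "\<dots> = (\<Sum>h\<in>H. 1 / of_nat (card H) * ?E $$ (i, j))"
  proof (rule sum.cong[OF refl])
    fix h assume h: "h \<in> H"
    have "(\<Sum>k<d. ?E $$ (i, k) * \<sigma> h $$ (k, j)) = (?E * \<sigma> h) $$ (i, j)"
      by (rule index_mult_mat_sum[OF avg_mat_carrier
            matrix_repD(1)[OF rep subgroup.mem_carrier[OF H h]] ij, symmetric])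
    thus "1 / of_nat (card H) * (\<Sum>k<d. ?E $$ (i, k) * \<sigma> h $$ (k, j))
      = 1 / of_nat (card H) * ?E $$ (i, j)"
      by (simp add: avg_mat_mult_subgroup[OF rep H h])
  qed
  also have "\<dots> = ?E $$ (i, j)" using c by simp
  finally show "(?E * ?E) $$ (i, j) = ?E $$ (i, j)" .
qed (simp_all add: avg_mat_def)

lemma fixed_mult_eq_mat_trace:
  assumes rep: "matrix_rep G d \<sigma>" and H: "subgroup H G"
  shows "fixed_mult H \<sigma> = mat_trace (avg_mat H d \<sigma>)"
proof -
  have "(\<Sum>h\<in>H. character \<sigma> h) = (\<Sum>h\<in>H. \<Sum>i<d. \<sigma> h $$ (i, i))"
    using carrier_matD(1)[OF matrix_repD(1)[OF rep subgroup.mem_carrier[OF H]]]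
    by (intro sum.cong) (simp_all add: character_def)
  also have "\<dots> = (\<Sum>i<d. \<Sum>h\<in>H. \<sigma> h $$ (i, i))" by (rule sum.swap)
  finally show ?thesis
    by (simp add: fixed_mult_def mat_trace_def avg_mat_def sum_distrib_left)
qed

lemma avg_proj_trace_fun:
  assumes rep: "matrix_rep G d \<sigma>" and H: "subgroup H G" and C: "C \<in> carrier_mat d d"
  shows "avg_proj G H (trace_fun G \<sigma> C) = trace_fun G \<sigma> (C * avg_mat H d \<sigma>)"
proof
  fix g
  let ?E = "avg_mat H d \<sigma>"
  note s = matrix_repD[OF rep]
  show "avg_proj G H (trace_fun G \<sigma> C) g = trace_fun G \<sigma> (C * ?E) g"
  proof (cases "g \<in> carrier G")
    case g: True
    have hg: "h \<otimes> g \<in> carrier G" if "h \<in> H" for h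
      using g subgroup.mem_carrier[OF H that] by simp
    have E: "?E * \<sigma> g \<in> carrier_mat d d" by (rule mult_carrier_mat[OF avg_mat_carrier s(1)[OF g]])
    have "trace_fun G \<sigma> (C * ?E) g = mat_trace (C * (?E * \<sigma> g))"
      using g assoc_mult_mat[OF C avg_mat_carrier[of H d \<sigma>] s(1)[OF g]] by (simp add: trace_fun_def)
    also have "\<dots> = (\<Sum>a<d. \<Sum>b<d. C $$ (a, b) * (?E * \<sigma> g) $$ (b, a))"
      by (rule mat_trace_mult[OF C E])
    also have "\<dots> = (\<Sum>a<d. \<Sum>b<d. \<Sum>h\<in>H. 1 / of_nat (card H) * (C $$ (a, b) * \<sigma> (h \<otimes> g) $$ (b, a)))"
      by (intro sum.cong[OF refl])
        (simp add: index_avg_mat_mult[OF rep H g] sum_distrib_left mult_ac del: index_mult_mat)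
    also have "\<dots> = (\<Sum>a<d. \<Sum>h\<in>H. \<Sum>b<d. 1 / of_nat (card H) * (C $$ (a, b) * \<sigma> (h \<otimes> g) $$ (b, a)))"
      by (intro sum.cong[OF refl] sum.swap)
    also have "\<dots> = (\<Sum>h\<in>H. \<Sum>a<d. \<Sum>b<d. 1 / of_nat (card H) * (C $$ (a, b) * \<sigma> (h \<otimes> g) $$ (b, a)))"
      by (rule sum.swap)
    also have "\<dots> = (\<Sum>h\<in>H. 1 / of_nat (card H) * trace_fun G \<sigma> C (h \<otimes> g))"
      by (intro sum.cong[OF refl])
        (simp add: trace_fun_def hg mat_trace_mult[OF C s(1)[OF hg]] sum_distrib_left)
    also have "\<dots> = avg_proj G H (trace_fun G \<sigma> C) g"
      using g by (simp add: avg_proj_def sum_distrib_left)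
    finally show ?thesis by simp
  qed (simp add: avg_proj_def trace_fun_def)
qed

lemma avg_proj_fixes:
  assumes "F \<in> L2_inv G H" "finite H" "H \<noteq> {}"
  shows "avg_proj G H F = F"
  using assms by (auto simp: avg_proj_def L2_inv_def L2_def fun_eq_iff)

text \<open>Pairing the function with the entry (k, l) of \<sigma>(g^-1) isolates the coefficient of
  \<open>C\<close> at (k, l), up to the nonzero factor given by the group order over the
  degree.\<close>

lemma trace_fun_inj:
  assumes \<sigma>: "\<sigma> \<in> irreps G" and fin: "finite (carrier G)"
    and C: "C \<in> carrier_mat (rep_degree G \<sigma>) (rep_degree G \<sigma>)"
    and zero: "\<And>g. trace_fun G \<sigma> C g = 0"
  shows "C = 0\<^sub>m (rep_degree G \<sigma>) (rep_degree G \<sigma>)"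
proof (rule eq_matI)
  let ?d = "rep_degree G \<sigma>" and ?n = "of_nat (Coset.order G) :: complex"
  note s = matrix_repD[OF irrepsD(1)[OF \<sigma>]]
  fix k l assume "k < dim_row (0\<^sub>m ?d ?d :: complex mat)" "l < dim_col (0\<^sub>m ?d ?d :: complex mat)"
  hence kl: "k < ?d" "l < ?d" by auto
  have "0 = (\<Sum>g\<in>carrier G. trace_fun G \<sigma> C g * \<sigma> (inv g) $$ (k, l))" using zero by simp
  also have "\<dots> = (\<Sum>g\<in>carrier G. \<Sum>a<?d. \<Sum>b<?d. C $$ (a, b) * (\<sigma> g $$ (b, a) * \<sigma> (inv g) $$ (k, l)))"
    by (intro sum.cong[OF refl])
      (simp add: trace_fun_def mat_trace_mult[OF C s(1)] sum_distrib_right mult.assoc)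
  also have "\<dots> = (\<Sum>a<?d. \<Sum>g\<in>carrier G. \<Sum>b<?d. C $$ (a, b) * (\<sigma> g $$ (b, a) * \<sigma> (inv g) $$ (k, l)))"
    by (rule sum.swap)
  also have "\<dots> = (\<Sum>a<?d. \<Sum>b<?d. \<Sum>g\<in>carrier G. C $$ (a, b) * (\<sigma> g $$ (b, a) * \<sigma> (inv g) $$ (k, l)))"
    by (intro sum.cong[OF refl] sum.swap)
  also have "\<dots> = (\<Sum>a<?d. \<Sum>b<?d. if a = k then if b = l then C $$ (a, b) * (?n / of_nat ?d) else 0 else 0)"
    using kl by (intro sum.cong[OF refl])
      (simp add: sum_distrib_left[symmetric] entries_orthogonal_same[OF \<sigma>])
  also have "\<dots> = (\<Sum>a<?d. if a = k then C $$ (a, l) * (?n / of_nat ?d) else 0)"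
    using kl by (intro sum.cong) auto
  also have "\<dots> = C $$ (k, l) * (?n / of_nat ?d)" using kl by simp
  finally have "C $$ (k, l) * (?n / of_nat ?d) = 0" by simp
  moreover have "?n \<noteq> 0" using order_gt_0_iff_finite fin by simp
  moreover have "?d \<noteq> 0" using irrepsD(2)[OF \<sigma>] by simp
  ultimately show "C $$ (k, l) = 0\<^sub>m ?d ?d $$ (k, l)" using kl by simp
qed (use C in auto)

text \<open>The map sending a d by r matrix D to the trace function of D B is linear and injective,
  as D = (D B) A. Its image is the invariant part of the block, and the matrix units are sent to a
  basis.\<close>

lemma dim_block_L2_inv:
  assumes \<sigma>: "\<sigma> \<in> irreps G" and fin: "finite (carrier G)" and H: "subgroup H G"
  shows "of_nat (cfun.dim (block G \<sigma> \<inter> L2_inv G H)) = of_nat (rep_degree G \<sigma>) * fixed_mult H \<sigma>"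
proof -
  define d where "d = rep_degree G \<sigma>"
  note rep = irrepsD(1)[OF \<sigma>, folded d_def]
  note s = matrix_repD[OF rep]
  let ?E = "avg_mat H d \<sigma>"
  have HG: "H \<subseteq> carrier G" using H by (rule subgroup.subset)
  have finH: "finite H" using HG fin by (rule finite_subset)
  have H0: "H \<noteq> {}" using subgroup.one_closed[OF H] by blast
  obtain r A B where A: "A \<in> carrier_mat d r" and B: "B \<in> carrier_mat r d"
    and AB: "A * B = ?E" and BA: "B * A = 1\<^sub>m r"
    by (rule idempotent_factorization[OF avg_mat_carrier avg_mat_idempotent[OF rep H finH]])
  \<comment> \<open>From B A = 1 follows B E = (B A) B = B. Since E absorbs \<sigma>(h) on its
    right, B does so too, and this is the source of the invariance of the functions
    \<open>b\<close>.\<close>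
  have BE: "B * ?E = B"
    unfolding AB[symmetric] using assoc_mult_mat[OF B A B] BA B by simp
  have Bh: "B * \<sigma> h = B" if h: "h \<in> H" for h
  proof -
    have "B * \<sigma> h = B * (?E * \<sigma> h)"
      using assoc_mult_mat[OF B avg_mat_carrier[of H d \<sigma>] s(1)[OF subgroup.mem_carrier[OF H h]]] BE by simp
    thus ?thesis using avg_mat_mult_subgroup[OF rep H h] BE by simp
  qed
  define I where "I = {..<d} \<times> {..<r}"
  \<comment> \<open>the entries of \<open>B \<sigma>\<close>, which will be a basis of the invariant functions in the block\<close>
  define b where "b p = (\<lambda>g. if g \<in> carrier G then (B * \<sigma> g) $$ (snd p, fst p) else 0)" for p
  \<comment> \<open>The trace of D (B \<sigma>(g)) pairs D at (i, j) with B \<sigma>(g) at (j, i);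
    this explains the swapped components in \<open>b\<close>.\<close>
  have comb: "(\<Sum>p\<in>I. fun_scale (c p) (b p)) = trace_fun G \<sigma> (mat d r c * B)" for c
  proof
    fix g
    show "(\<Sum>p\<in>I. fun_scale (c p) (b p)) g = trace_fun G \<sigma> (mat d r c * B) g"
    proof (cases "g \<in> carrier G")
      case g: True
      have "trace_fun G \<sigma> (mat d r c * B) g = mat_trace (mat d r c * (B * \<sigma> g))"
        using g assoc_mult_mat[OF _ B s(1)[OF g], of "mat d r c" d] by (simp add: trace_fun_def)
      also have "\<dots> = (\<Sum>i<d. \<Sum>j<r. c (i, j) * (B * \<sigma> g) $$ (j, i))"
        using mat_trace_mult[OF mat_carrier mult_carrier_mat[OF B s(1)[OF g]], of c] by simp
      also have "\<dots> = (\<Sum>p\<in>I. fun_scale (c p) (b p) g)"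
        using g unfolding I_def sum.cartesian_product
        by (intro sum.cong) (auto simp: fun_scale_def b_def)
      finally show ?thesis by (simp add: sum_fun_apply)
    qed (simp add: sum_fun_apply fun_scale_def b_def trace_fun_def)
  qed
  have zero: "c p = 0" if c: "(\<Sum>p\<in>I. fun_scale (c p) (b p)) = 0" and p: "p \<in> I" for c p
  proof -
    let ?D = "mat d r c"
    have D: "?D \<in> carrier_mat d r" by simp
    have "?D * B = 0\<^sub>m d d"
      using trace_fun_inj[OF \<sigma> fin, folded d_def, of "?D * B"] c[unfolded comb] D B
      by (simp add: fun_eq_iff)
    \<comment> \<open>Multiplication by \<open>A\<close> on the right cancels
      \<open>B\<close>.\<close>
    hence "?D = 0\<^sub>m d d * A"
      using assoc_mult_mat[OF D B A] BA D by simp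
    hence "?D = 0\<^sub>m d r" using A by simp
    hence "?D $$ p = 0" using p by (auto simp: I_def)
    thus ?thesis using p by (auto simp: I_def)
  qed
  have finI: "finite I" and cardI: "card I = d * r" by (simp_all add: I_def)
  have inj: "inj_on b I"
  proof (rule inj_onI, rule ccontr)
    fix p q assume pq: "p \<in> I" "q \<in> I" "b p = b q" "p \<noteq> q"
    let ?c = "\<lambda>x. if x = p then 1 else if x = q then - 1 else 0 :: complex"
    have "(\<Sum>x\<in>I. fun_scale (?c x) (b x)) = (\<Sum>x\<in>{p, q}. fun_scale (?c x) (b x))"
      using pq finI by (intro sum.mono_neutral_right) (auto simp: fun_scale_def)
    also have "\<dots> = 0" using pq by (simp add: fun_scale_def fun_eq_iff)
    finally have "?c p = 0" by (rule zero) (rule pq(1))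
    thus False by simp
  qed
  have "cfun.independent (b ` I)"
  proof (rule cfun.independent_if_scalars_zero)
    fix f x assume f: "(\<Sum>x\<in>b ` I. fun_scale (f x) x) = 0" and x: "x \<in> b ` I"
    from x obtain p where p: "p \<in> I" "x = b p" by blast
    have "(\<Sum>p\<in>I. fun_scale (f (b p)) (b p)) = 0" using f by (simp add: sum.reindex[OF inj])
    from zero[OF this p(1)] show "f x = 0" using p by simp
  qed (simp add: finI)
  moreover have "b ` I \<subseteq> block G \<sigma> \<inter> L2_inv G H"
  proof safe
    fix i j assume "(i, j) \<in> I"
    hence ij: "i < d" "j < r" by (auto simp: I_def)
    have "b (i, j) = (\<Sum>p\<in>I. fun_scale (if p = (i, j) then 1 else 0) (b p))"
      using finI \<open>(i, j) \<in> I\<close>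
      by (subst sum.remove[of _ "(i, j)"]) (auto simp: fun_scale_def fun_eq_iff sum_fun_apply)
    also have "\<dots> = trace_fun G \<sigma> (mat d r (\<lambda>p. if p = (i, j) then 1 else 0) * B)"
      by (rule comb)
    finally show "b (i, j) \<in> block G \<sigma>"
      unfolding block_eq_trace_fun[OF rep]
      using mult_carrier_mat[OF mat_carrier B] by (simp only: imageI)
    have "b (i, j) (h \<otimes> g) = b (i, j) g" if h: "h \<in> H" and g: "g \<in> carrier G" for h g
    proof -
      have hG: "h \<in> carrier G" using h HG by blast
      have "B * \<sigma> (h \<otimes> g) = B * \<sigma> g"
        unfolding s(2)[OF hG g] using assoc_mult_mat[OF B s(1)[OF hG] s(1)[OF g]] Bh[OF h] by simp
      thus ?thesis using hG g by (simp add: b_def)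
    qed
    thus "b (i, j) \<in> L2_inv G H" by (simp add: L2_inv_def L2_def b_def)
  qed
  moreover have "block G \<sigma> \<inter> L2_inv G H \<subseteq> cfun.span (b ` I)"
  proof
    fix F assume F: "F \<in> block G \<sigma> \<inter> L2_inv G H"
    then obtain C where C: "C \<in> carrier_mat d d" "F = trace_fun G \<sigma> C"
      unfolding block_eq_trace_fun[OF rep] by blast
    have CA: "C * A \<in> carrier_mat d r" using C A by simp
    \<comment> \<open>An invariant function equals its own average, so its coefficient matrix may be
      replaced by C E = (C A) B, which displays the coordinates of the function in the family
      \<open>b\<close>.\<close>
    have "F = avg_proj G H F" using avg_proj_fixes F finH H0 by simp
    also have "\<dots> = trace_fun G \<sigma> (C * ?E)"
      unfolding C(2) by (rule avg_proj_trace_fun[OF rep H C(1)])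
    also have "C * ?E = mat d r (\<lambda>p. (C * A) $$ p) * B"
    proof -
      have "mat d r (\<lambda>p. (C * A) $$ p) = C * A" using carrier_matD[OF CA]
        by (intro eq_matI) (simp_all del: index_mult_mat)
      thus ?thesis using assoc_mult_mat[OF C(1) A B] AB by simp
    qed
    also have "trace_fun G \<sigma> \<dots> = (\<Sum>p\<in>I. fun_scale ((C * A) $$ p) (b p))"
      by (rule comb[symmetric])
    also have "\<dots> \<in> cfun.span (b ` I)"
      by (intro cfun.span_sum cfun.span_scale cfun.span_base) auto
    finally show "F \<in> cfun.span (b ` I)" .
  qed
  ultimately have "cfun.dim (block G \<sigma> \<inter> L2_inv G H) = d * r"
    using cardI card_image[OF inj] by (intro cfun.dim_unique[of "b ` I"]) auto
  moreover have "fixed_mult H \<sigma> = of_nat r"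
  proof -
    have "fixed_mult H \<sigma> = mat_trace (A * B)"
      unfolding AB by (rule fixed_mult_eq_mat_trace[OF rep H])
    also have "\<dots> = mat_trace (1\<^sub>m r)" using mat_trace_mult_comm[OF A B] BA by simp
    finally show ?thesis by (simp add: mat_trace_def)
  qed
  ultimately show ?thesis by (simp add: d_def)
qed

end

theorem proposition9:
  fixes G :: "('g, 'm) monoid_scheme" and X :: "'x set" and \<phi> :: "'g \<Rightarrow> 'x \<Rightarrow> 'x"
    and x\<^sub>0 :: 'x and H :: "'g set"
    and \<rho> :: "('g \<Rightarrow> complex mat) set \<Rightarrow> 'g \<Rightarrow> complex mat"
  assumes "transitive_action G X \<phi>"
    and "finite (carrier G)"
    and "finite X"
    and "x\<^sub>0 \<in> X"
    and "H = stabilizer G \<phi> x\<^sub>0"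
    and "unitary_representatives G \<rho>"
  shows "(\<forall>C\<in>dual G.
            avg_proj G H ` block G (\<rho> C) \<subseteq> block G (\<rho> C) \<and>
            of_nat (cfun.dim (block G (\<rho> C) \<inter> L2_inv G H))
              = of_nat (rep_degree G (\<rho> C)) * fixed_mult H (\<rho> C)) \<and>
         (\<Sum>C\<in>dual G. of_nat (rep_degree G (\<rho> C)) * fixed_mult H (\<rho> C)) = of_nat (card X)"
proof (intro conjI ballI)
  interpret transitive_action G X \<phi> by fact
  interpret group G by (rule group_hom.axioms(1)[OF group_hom])
  have H: "subgroup H G" unfolding assms(5) by (rule stabilizer_subgroup[OF assms(4)])
  have HG: "H \<subseteq> carrier G" using H by (rule subgroup.subset)
  have finH: "finite H" using HG assms(2) by (rule finite_subset)
  have H0: "card H > 0" using finH subgroup.one_closed[OF H] by (auto simp: card_gt_0_iff)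
  {
    fix C assume C: "C \<in> dual G"
    note irr = dual_class(1)[OF assms(6) C]
    note rep = irrepsD(1)[OF irr]
    show "avg_proj G H ` block G (\<rho> C) \<subseteq> block G (\<rho> C)"
      unfolding block_eq_trace_fun[OF rep]
      using avg_proj_trace_fun[OF rep H] avg_mat_carrier by (auto intro!: imageI)
    show "of_nat (cfun.dim (block G (\<rho> C) \<inter> L2_inv G H))
      = of_nat (rep_degree G (\<rho> C)) * fixed_mult H (\<rho> C)"
      by (rule dim_block_L2_inv[OF irr assms(2) H])
  }
  \<comment> \<open>Transitivity enters here: the orbit is all of X, so the orbit-stabilizer theorem
    counts X.\<close>
  have "orbit G \<phi> x\<^sub>0 = X"
    using unique_orbit[OF assms(4)] element_image[OF _ assms(4)] by (auto simp: orbit_def)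
  hence card: "card X * card H = Coset.order G"
    using orbit_stabilizer_theorem[OF assms(4)] assms(5) by simp
  have "(\<Sum>C\<in>dual G. of_nat (rep_degree G (\<rho> C)) * fixed_mult H (\<rho> C))
    = (\<Sum>C\<in>dual G. \<Sum>h\<in>H. 1 / of_nat (card H) * (of_nat (rep_degree G (\<rho> C)) * character (\<rho> C) h))"
    by (simp add: fixed_mult_def sum_distrib_left sum_divide_distrib)
  also have "\<dots> = (\<Sum>h\<in>H. 1 / of_nat (card H)
      * (\<Sum>C\<in>dual G. of_nat (rep_degree G (\<rho> C)) * character (\<rho> C) h))"
    by (subst sum.swap) (simp add: sum_distrib_left)
  \<comment> \<open>The inner sum is the regular character at h; only the identity of H survives,
    leaving the group order divided by the order of H.\<close>
  also have "\<dots> = (\<Sum>h\<in>H. if h = \<one>\<^bsub>G\<^esub> then 1 / of_nat (card H) * of_nat (Coset.order G) else 0)"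
    using HG by (intro sum.cong[OF refl]) (auto simp: sum_degree_character[OF assms(2,6)])
  also have "\<dots> = of_nat (card X)"
    using finH H0 subgroup.one_closed[OF H] by (auto simp flip: card)
  finally show "(\<Sum>C\<in>dual G. of_nat (rep_degree G (\<rho> C)) * fixed_mult H (\<rho> C)) = of_nat (card X)" .
qed

end
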